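(* Let $n\ge 1$ be an integer and let $b\in\mathbb{R}$ be a parameter such that the Bogoslovsky space $\mathbb{R}^{n+1}\ni(y^0,\dots,y^n)$ with $L=-\frac12F^2$, $$F=\Big[2y^0y^n-\sum_{i=1}^{n-1}(y^i)^2\Big]^{(1-b)/2}(y^0)^b,$$ is a Lorentz-Minkowski space. Let $(M,\mathscr{L})$ be an $(n+1)$-dimensional Lorentz-Finsler space with coordinates $\{u,v,\{x^i\}_{i=1,\dots,n-1}\}$ modeled on this Bogoslovsky Lorentz-Minkowski space, for which the vierbein can be chosen in the local form \begin{align*} y^0&=U(u)\,du,\\ y^i&=\sum_{j=1}^{n-1}Z^i_j(\vec x,u)\,dx^j+Z^i(\vec x,u)\,du,\qquad i=1,\dots,n-1,\\ y^n&=dv+V(\vec x,u,v)\,du+\sum_{j=1}^{n-1}V_j(\vec x,u)\,dx^j, \end{align*} where $U,Z^i_j,Z^i,V,V_j$ are arbitrary $C^1$ functions with the matrix $(Z^i_j)$ invertible and $U\neq0$. Then $(M,\mathscr{L})$ is a Berwald space.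
   Context: A pseudo-Minkowski space is a pair $(V,L)$ where $V$ is a finite-dimensional real vector space and $L\colon\bar\omega\to\mathbb{R}$ is defined on the closure of an open cone $\omega\subset V$ with vertex the origin, such that $L\in C^4(\omega)\cap C^0(\bar\omega)$, $L(sy)=s^2L(y)$ for all $s>0$, and the Hessian $(\partial_\mu\partial_\nu L)$ in linear coordinates is non-degenerate on $\omega$. It is a Lorentz-Minkowski space if the Hessian has Lorentzian signature and $\omega$ is a sharp convex cone. For the Bogoslovsky space the cone is $\omega=\{y^0>0,\ 2y^0y^n-\sum_{i=1}^{n-1}(y^i)^2>0\}$. A pseudo-Finsler (resp. Lorentz-Finsler) space is a pair $(M,\mathscr{L})$ with $\mathscr{L}\colon\bar\Omega\to\mathbb{R}$, $\Omega\subset TM$ projecting onto $M$, such that for each $x$, with $\Omega_x=\Omega\cap T_xM$ and $\mathscr{L}_x=\mathscr{L}|_{\bar\Omega_x}$, the pair $(T_xM,\mathscr{L}_x)$ is a pseudo-Minkowski (resp. Lorentz-Minkowski) space. The space is modeled on $(V,L)$, $V=\mathbb{R}^{n+1}$, with vierbein $\{y^a\}_{a=0,\dots,n}$ if $y^0,\dots,y^n$ are linearly independent local 1-forms on $M$ such that the linear isomorphism $\varphi_x\colon T_xM\to V$, $w\mapsto (y^0(w),\dots,y^n(w))$, satisfies $\varphi_x(\Omega_x)=\omega$ and $\mathscr{L}_x(w)=L(\varphi_x(w))$ for all $w\in\bar\Omega_x$. Thus $\mathscr{L}$ is obtained by inserting in $L=-\frac12F^2$ the 1-forms $y^a$ evaluated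 on tangent vectors. In local coordinates $x^\mu$ on $M$ with induced fibre coordinates $y^\mu$, with $g_{\mu\nu}=\partial^2\mathscr{L}/\partial y^\mu\partial y^\nu$ and inverse $g^{\mu\nu}$, the spray is $G^\mu=\frac12g^{\mu\sigma}\big(\frac{\partial^2\mathscr{L}}{\partial x^\rho\partial y^\sigma}y^\rho-\frac{\partial\mathscr{L}}{\partial x^\sigma}\big)$. The space is Berwald if $G^\mu(x,y)$ is quadratic in the fibre coordinates for each $x$. *)

theory Defs
  imports "HOL-Analysis.Analysis"
begin

text \<open>Calculus on open subsets of a coordinate space.\<close>

definition partial :: "'m::finite \<Rightarrow> (real^'m \<Rightarrow> 'b::real_normed_vector) \<Rightarrow> real^'m \<Rightarrow> 'b" where
  "partial i f x = frechet_derivative f (at x) (axis i 1)"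

primrec Ck_on :: "nat \<Rightarrow> (real^'m::finite) set \<Rightarrow> (real^'m \<Rightarrow> 'b::real_normed_vector) \<Rightarrow> bool" where
  "Ck_on 0 S f \<longleftrightarrow> continuous_on S f"
| "Ck_on (Suc k) S f \<longleftrightarrow> (\<forall>x\<in>S. f differentiable (at x)) \<and> (\<forall>i. Ck_on k S (partial i f))"

definition smooth_on :: "(real^'m::finite) set \<Rightarrow> (real^'m \<Rightarrow> 'b::real_normed_vector) \<Rightarrow> bool" where
  "smooth_on S f \<longleftrightarrow> (\<forall>k. Ck_on k S f)"

definition hessian :: "(real^'m::finite \<Rightarrow> real) \<Rightarrow> real^'m \<Rightarrow> real^'m^'m" where
  "hessian L y = (\<chi> \<mu> \<nu>. partial \<mu> (\<lambda>z. partial \<nu> L z) y)"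

text \<open>Pseudo-Minkowski and Lorentz-Minkowski spaces on a coordinate space. Only the values of
  \<open>L\<close> on \<open>closure \<omega>\<close> matter. The Lorentzian signature is \<open>(-,+,...,+)\<close>.\<close>

definition pseudo_minkowski :: "(real^'m::finite) set \<Rightarrow> (real^'m \<Rightarrow> real) \<Rightarrow> bool" where
  "pseudo_minkowski \<omega> L \<longleftrightarrow>
     open \<omega> \<and> \<omega> \<noteq> {} \<and> (\<forall>y\<in>\<omega>. \<forall>s>0. s *\<^sub>R y \<in> \<omega>) \<and>
     Ck_on 4 \<omega> L \<and> continuous_on (closure \<omega>) L \<and>
     (\<forall>y\<in>closure \<omega>. \<forall>s>0. L (s *\<^sub>R y) = s\<^sup>2 * L y) \<and>
     (\<forall>y\<in>\<omega>. invertible (hessian L y))"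

definition lorentzian_signature :: "real^'m::finite^'m \<Rightarrow> bool" where
  "lorentzian_signature H \<longleftrightarrow>
     (\<exists>(P :: real^'m^'m) k. invertible P \<and>
        transpose P ** H ** P = (\<chi> i j. if i = j then (if i = k then -1 else 1) else 0))"

definition sharp_convex :: "(real^'m::finite) set \<Rightarrow> bool" where
  "sharp_convex \<omega> \<longleftrightarrow> convex \<omega> \<and> (\<forall>v. v \<in> closure \<omega> \<and> - v \<in> closure \<omega> \<longrightarrow> v = 0)"

definition lorentz_minkowski :: "(real^'m::finite) set \<Rightarrow> (real^'m \<Rightarrow> real) \<Rightarrow> bool" where
  "lorentz_minkowski \<omega> L \<longleftrightarrow>
     pseudo_minkowski \<omega> L \<and> (\<forall>y\<in>\<omega>. lorentzian_signature (hessian L y)) \<and> sharp_convex \<omega>"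

text \<open>The Bogoslovsky space on \<open>\<real>\<^sup>n\<^sup>+\<^sup>1\<close>. Throughout, a bijection \<open>ix\<close> from
  \<open>{0..n}\<close> onto the index type \<open>'m\<close> fixes the numbering of coordinates, so
  \<open>y $ ix a\<close> is the component with number \<open>a\<close>. On the boundary of the cone the convention
  \<open>0 powr a = 0\<close> gives the value zero, which is the only possible continuous extension whenever
  the space is Lorentz-Minkowski.\<close>

definition bogoslovsky_Q :: "nat \<Rightarrow> (nat \<Rightarrow> 'm::finite) \<Rightarrow> real^'m \<Rightarrow> real" where
  "bogoslovsky_Q n ix y = 2 * y $ ix 0 * y $ ix n - (\<Sum>i\<in>{1..<n}. (y $ ix i)\<^sup>2)"

definition bogoslovsky_cone :: "nat \<Rightarrow> (nat \<Rightarrow> 'm::finite) \<Rightarrow> (real^'m) set" where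
  "bogoslovsky_cone n ix = {y. y $ ix 0 > 0 \<and> bogoslovsky_Q n ix y > 0}"

definition bogoslovsky_F :: "nat \<Rightarrow> (nat \<Rightarrow> 'm::finite) \<Rightarrow> real \<Rightarrow> real^'m \<Rightarrow> real" where
  "bogoslovsky_F n ix b y = bogoslovsky_Q n ix y powr ((1 - b) / 2) * (y $ ix 0) powr b"

definition bogoslovsky_L :: "nat \<Rightarrow> (nat \<Rightarrow> 'm::finite) \<Rightarrow> real \<Rightarrow> real^'m \<Rightarrow> real" where
  "bogoslovsky_L n ix b y = - (1/2) * (bogoslovsky_F n ix b y)\<^sup>2"

text \<open>Smooth manifolds. The manifold is the topological type \<open>'p\<close> with an atlas; it has
  dimension \<open>CARD('m)\<close>. A chart is a domain with a coordinate map. The atlas need not be maximal.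
\<close>

type_synonym ('p, 'm) chart = "'p set \<times> ('p \<Rightarrow> real^'m)"

definition chart_point :: "('p, 'm::finite) chart \<Rightarrow> real^'m \<Rightarrow> 'p" where
  "chart_point c = inv_into (fst c) (snd c)"

definition transition :: "('p, 'm::finite) chart \<Rightarrow> ('p, 'm) chart \<Rightarrow> real^'m \<Rightarrow> real^'m" where
  "transition c c' = snd c' \<circ> chart_point c"

definition smooth_atlas ::
    "('p::{t2_space,second_countable_topology}, 'm::finite) chart set \<Rightarrow> bool" where
  "smooth_atlas A \<longleftrightarrow>
     (\<forall>c\<in>A. open (fst c) \<and> open (snd c ` fst c) \<and>
             homeomorphism (fst c) (snd c ` fst c) (snd c) (chart_point c)) \<and>
     (\<Union>c\<in>A. fst c) = UNIV \<and>
     (\<forall>c\<in>A. \<forall>c'\<in>A. smooth_on (snd c ` (fst c \<inter> fst c')) (transition c c'))"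

text \<open>A tangent vector at \<open>p\<close> is the family of its component vectors in all charts around \<open>p\<close>,
  related by the contravariant transformation law (and padded by zero for other arguments).\<close>

type_synonym ('p, 'm) tvec = "('p, 'm) chart \<Rightarrow> real^'m"

definition tangent_space :: "('p, 'm::finite) chart set \<Rightarrow> 'p \<Rightarrow> ('p, 'm) tvec set" where
  "tangent_space A p =
     {w. (\<forall>c\<in>A. \<forall>c'\<in>A. p \<in> fst c \<inter> fst c' \<longrightarrow>
            w c' = frechet_derivative (transition c c') (at (snd c p)) (w c)) \<and>
         (\<forall>c. \<not> (c \<in> A \<and> p \<in> fst c) \<longrightarrow> w c = 0)}"

definition tvec_of :: "('p, 'm::finite) chart set \<Rightarrow> ('p, 'm) chart \<Rightarrow> 'p \<Rightarrow> real^'m \<Rightarrow> ('p, 'm) tvec" where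
  "tvec_of A c p y = (THE w. w \<in> tangent_space A p \<and> w c = y)"

definition tangent_bundle :: "('p, 'm::finite) chart set \<Rightarrow> ('p \<times> ('p, 'm) tvec) set" where
  "tangent_bundle A = {(p, w). w \<in> tangent_space A p}"

definition covector :: "('p, 'm::finite) chart set \<Rightarrow> 'p \<Rightarrow> (('p, 'm) tvec \<Rightarrow> real) \<Rightarrow> bool" where
  "covector A p \<alpha> \<longleftrightarrow>
     (\<forall>w\<in>tangent_space A p. \<forall>w'\<in>tangent_space A p. \<alpha> (\<lambda>c. w c + w' c) = \<alpha> w + \<alpha> w') \<and>
     (\<forall>w\<in>tangent_space A p. \<forall>r. \<alpha> (\<lambda>c. r *\<^sub>R w c) = r * \<alpha> w)"

text \<open>Finsler structures: \<open>\<Omega>\<close> is a subset of the tangent bundle and \<open>\<L>\<close> a function of a point and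
  a tangent vector there. The vector space structure and topology of a tangent space are
  transported through the charts.\<close>

definition fibre :: "('p \<times> ('p, 'm::finite) tvec) set \<Rightarrow> 'p \<Rightarrow> ('p, 'm) tvec set" where
  "fibre \<Omega> p = {w. (p, w) \<in> \<Omega>}"

definition fibre_in_chart ::
    "('p \<times> ('p, 'm::finite) tvec) set \<Rightarrow> ('p, 'm) chart \<Rightarrow> 'p \<Rightarrow> (real^'m) set" where
  "fibre_in_chart \<Omega> c p = (\<lambda>w. w c) ` fibre \<Omega> p"

definition fibre_closure ::
    "('p, 'm::finite) chart set \<Rightarrow> ('p \<times> ('p, 'm) tvec) set \<Rightarrow> 'p \<Rightarrow> ('p, 'm) tvec set" where
  "fibre_closure A \<Omega> p =
     {w \<in> tangent_space A p. \<forall>c\<in>A. p \<in> fst c \<longrightarrow> w c \<in> closure (fibre_in_chart \<Omega> c p)}"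

definition local_lagrangian ::
    "('p, 'm::finite) chart set \<Rightarrow> ('p \<Rightarrow> ('p, 'm) tvec \<Rightarrow> real) \<Rightarrow> ('p, 'm) chart
      \<Rightarrow> real^'m \<Rightarrow> real^'m \<Rightarrow> real" where
  "local_lagrangian A \<L> c x y = \<L> (chart_point c x) (tvec_of A c (chart_point c x) y)"

definition lorentz_finsler ::
    "('p, 'm::finite) chart set \<Rightarrow> ('p \<times> ('p, 'm) tvec) set \<Rightarrow> ('p \<Rightarrow> ('p, 'm) tvec \<Rightarrow> real) \<Rightarrow> bool" where
  "lorentz_finsler A \<Omega> \<L> \<longleftrightarrow>
     \<Omega> \<subseteq> tangent_bundle A \<and> fst ` \<Omega> = UNIV \<and>
     (\<forall>c\<in>A. \<forall>p\<in>fst c.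
        lorentz_minkowski (fibre_in_chart \<Omega> c p) (local_lagrangian A \<L> c (snd c p)))"

definition spray :: "(real^'m::finite \<Rightarrow> real^'m \<Rightarrow> real) \<Rightarrow> real^'m \<Rightarrow> real^'m \<Rightarrow> real^'m" where
  "spray l x y =
     (\<chi> \<mu>. (1/2) * (\<Sum>\<sigma>\<in>UNIV. matrix_inv (hessian (l x) y) $ \<mu> $ \<sigma> *
        ((\<Sum>\<rho>\<in>UNIV. partial \<rho> (\<lambda>x'. partial \<sigma> (l x') y) x * y $ \<rho>)
          - partial \<sigma> (\<lambda>x'. l x' y) x)))"

definition berwald ::
    "('p, 'm::finite) chart set \<Rightarrow> ('p \<times> ('p, 'm) tvec) set \<Rightarrow> ('p \<Rightarrow> ('p, 'm) tvec \<Rightarrow> real) \<Rightarrow> bool" where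
  "berwald A \<Omega> \<L> \<longleftrightarrow>
     (\<forall>c\<in>A. \<forall>p\<in>fst c. \<exists>\<Gamma> :: 'm \<Rightarrow> 'm \<Rightarrow> 'm \<Rightarrow> real. \<forall>y\<in>fibre_in_chart \<Omega> c p. \<forall>\<mu>.
        spray (local_lagrangian A \<L> c) (snd c p) y $ \<mu>
          = (\<Sum>\<alpha>\<in>UNIV. \<Sum>\<beta>\<in>UNIV. \<Gamma> \<mu> \<alpha> \<beta> * y $ \<alpha> * y $ \<beta>))"

text \<open>The 1-forms \<open>e k\<close> are a vierbein on \<open>D\<close> exhibiting the space as modeled on \<open>(\<omega>, L)\<close>.\<close>

definition modeled_with_vierbein ::
    "('p, 'm::finite) chart set \<Rightarrow> ('p \<times> ('p, 'm) tvec) set \<Rightarrow> ('p \<Rightarrow> ('p, 'm) tvec \<Rightarrow> real)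
      \<Rightarrow> (real^'m) set \<Rightarrow> (real^'m \<Rightarrow> real) \<Rightarrow> 'p set \<Rightarrow> ('m \<Rightarrow> 'p \<Rightarrow> ('p, 'm) tvec \<Rightarrow> real) \<Rightarrow> bool" where
  "modeled_with_vierbein A \<Omega> \<L> \<omega> L D e \<longleftrightarrow>
     (\<forall>p\<in>D.
        (\<forall>k. covector A p (e k p)) \<and>
        (\<forall>a :: 'm \<Rightarrow> real. (\<forall>w\<in>tangent_space A p. (\<Sum>k\<in>UNIV. a k * e k p w) = 0) \<longrightarrow> (\<forall>k. a k = 0)) \<and>
        (\<lambda>w. \<chi> k. e k p w) ` fibre \<Omega> p = \<omega> \<and>
        (\<forall>w\<in>fibre_closure A \<Omega> p. \<L> p w = L (\<chi> k. e k p w)))"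

definition depends_only_on :: "'m set \<Rightarrow> (real^'m::finite) set \<Rightarrow> (real^'m \<Rightarrow> real) \<Rightarrow> bool" where
  "depends_only_on J S f \<longleftrightarrow> (\<forall>x\<in>S. \<forall>x'\<in>S. (\<forall>j\<in>J. x $ j = x' $ j) \<longrightarrow> f x = f x')"

definition invertible_on :: "nat set \<Rightarrow> (nat \<Rightarrow> nat \<Rightarrow> real) \<Rightarrow> bool" where
  "invertible_on I Z \<longleftrightarrow>
     (\<exists>W. \<forall>i\<in>I. \<forall>k\<in>I. (\<Sum>j\<in>I. Z i j * W j k) = (if i = k then 1 else 0) \<and>
                        (\<Sum>j\<in>I. W i j * Z j k) = (if i = k then 1 else 0))"

text \<open>The local form of the vierbein in a chart \<open>c\<close> with coordinates numbered so that
  \<open>u = x $ ix 0\<close>, \<open>v = x $ ix n\<close>, and \<open>x $ ix i\<close> for \<open>0 < i < n\<close> are the remaining ones. The 1-form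
  \<open>du\<close> maps \<open>w\<close> to \<open>w c $ ix 0\<close>, and similarly for the others. Here \<open>Zm\<close> is the
  matrix, \<open>Z\<close> the vector, \<open>Vv\<close> the covector of coefficients.\<close>

definition vierbein_local_form ::
    "nat \<Rightarrow> (nat \<Rightarrow> 'm::finite) \<Rightarrow> ('p, 'm) chart set \<Rightarrow> ('p, 'm) chart
      \<Rightarrow> ('m \<Rightarrow> 'p \<Rightarrow> ('p, 'm) tvec \<Rightarrow> real) \<Rightarrow> bool" where
  "vierbein_local_form n ix A c e \<longleftrightarrow>
     (\<exists>(U :: real^'m \<Rightarrow> real) (Zm :: nat \<Rightarrow> nat \<Rightarrow> real^'m \<Rightarrow> real) (Z :: nat \<Rightarrow> real^'m \<Rightarrow> real)
        (V :: real^'m \<Rightarrow> real) (Vv :: nat \<Rightarrow> real^'m \<Rightarrow> real).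
        let S = snd c ` fst c; I = {1..<n} in
        Ck_on 1 S U \<and> depends_only_on {ix 0} S U \<and> (\<forall>x\<in>S. U x \<noteq> 0) \<and>
        (\<forall>i\<in>I. \<forall>j\<in>I. Ck_on 1 S (Zm i j) \<and> depends_only_on (ix ` {0..<n}) S (Zm i j)) \<and>
        (\<forall>x\<in>S. invertible_on I (\<lambda>i j. Zm i j x)) \<and>
        (\<forall>i\<in>I. Ck_on 1 S (Z i) \<and> depends_only_on (ix ` {0..<n}) S (Z i)) \<and>
        Ck_on 1 S V \<and>
        (\<forall>j\<in>I. Ck_on 1 S (Vv j) \<and> depends_only_on (ix ` {0..<n}) S (Vv j)) \<and>
        (\<forall>p\<in>fst c. \<forall>w\<in>tangent_space A p.
           e (ix 0) p w = U (snd c p) * w c $ ix 0 \<and>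
           (\<forall>i\<in>I. e (ix i) p w
              = (\<Sum>j\<in>I. Zm i j (snd c p) * w c $ ix j) + Z i (snd c p) * w c $ ix 0) \<and>
           e (ix n) p w
              = w c $ ix n + V (snd c p) * w c $ ix 0 + (\<Sum>j\<in>I. Vv j (snd c p) * w c $ ix j)))"

end

theory Submission
  imports Defs
begin

text \<open>In every chart the Lagrangian has the form \<open>L (N(x) y)\<close>, where \<open>N\<close> is the coframe, so
  \<open>G = (1/2) N\<^sup>-\<^sup>1 (N'(y) y + q)\<close>, where \<open>q\<close> solves \<open>H(z) q = \<Sum>\<^sub>a L\<^sub>a(z) C\<^sup>a(z, -)\<close>. Here
  \<open>z = N y\<close>, \<open>H\<close> is the Hessian of \<open>L\<close>, and \<open>C\<close> is the exterior derivative of the coframe written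
  in the coframe. As \<open>C\<close> is a tensor, it may be computed in the chart of the local form, where
  \<open>C\<^sup>0 = 0\<close>, \<open>C\<^sup>i(z, e\<^sub>n) = 0\<close>, and \<open>C\<^sup>n(z, e\<^sub>n)\<close> is a multiple of \<open>z\<^sup>0\<close>. Under exactly these
  conditions the equation has an explicit solution \<open>q\<close> quadratic in \<open>z\<close>, which exists for
  \<open>b \<noteq> -1, 1\<close>; both exceptions are excluded because the Hessian degenerates there.\<close>

section \<open>Symmetry of second derivatives\<close>

text \<open>The Berwald property is tested in every chart around a point, whereas the local form is
  given in one chart only. Composing with the transition map brings its second derivatives into
  \<open>N'\<close>; being symmetric, they cancel from the exterior derivative. This is why
  \<open>C\<close> is a tensor and why symmetry of second derivatives comes first. The coefficients
  of the coframe are only C^1, which suffices because the spray contains no second derivative in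
  position. The obstacle to a quadratic solution is the real powers in \<open>L\<close>. On the cone
  dL = P \<eta>(z, -) + T dz^0. Since C^0 = 0, the \<open>T\<close> part drops out of the right-hand
  side, which becomes P times an expression quadratic in z. On the left, \<open>P\<close> can be
  cancelled once the logarithmic derivatives of \<open>P\<close> and \<open>T\<close> along
  \<open>q\<close> are multiples of z^0. These involve q^0 / z^0, and the condition on C^n is what
  makes q^0 a multiple of (z^0)^2.\<close>

lemma partial_eqI:
  assumes "(f has_derivative f') (at x)"
  shows "partial i f x = f' (axis i 1)"
  unfolding partial_def using frechet_derivative_at[OF assms] by simp

lemma has_derivative_sum_partial:
  assumes "f differentiable (at x)"
  shows "(f has_derivative (\<lambda>h. \<Sum>i\<in>UNIV. h $ i *\<^sub>R partial i f x)) (at x)"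
proof -
  have d: "(f has_derivative frechet_derivative f (at x)) (at x)"
    using assms frechet_derivative_works by blast
  have "frechet_derivative f (at x) h = (\<Sum>i\<in>UNIV. h $ i *\<^sub>R partial i f x)" for h
  proof -
    interpret linear "frechet_derivative f (at x)"
      using assms by (rule linear_frechet_derivative)
    have "frechet_derivative f (at x) h = frechet_derivative f (at x) (\<Sum>i\<in>UNIV. h $ i *\<^sub>R axis i 1)"
      by (metis (no_types) basis_expansion scalar_mult_eq_scaleR)
    then show ?thesis by (simp add: sum scale partial_def)
  qed
  then have "frechet_derivative f (at x) = (\<lambda>h. \<Sum>i\<in>UNIV. h $ i *\<^sub>R partial i f x)" by blast
  then show ?thesis using d by simp
qed

lemma has_derivative_vec_lambda:
  fixes f :: "'a::real_normed_vector \<Rightarrow> 'm::finite \<Rightarrow> real"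
  assumes "\<And>i. ((\<lambda>x. f x i) has_derivative (\<lambda>h. f' h i)) (at x within S)"
  shows "((\<lambda>x. \<chi> i. f x i) has_derivative (\<lambda>h. \<chi> i. f' h i)) (at x within S)"
  by (subst has_derivative_componentwise_within) (auto simp: Basis_vec_def inner_axis assms)

lemma has_derivative_vec_nth:
  fixes f :: "'a::real_normed_vector \<Rightarrow> real^'m::finite"
  assumes "(f has_derivative f') F"
  shows "((\<lambda>x. f x $ i) has_derivative (\<lambda>h. f' h $ i)) F"
  by (rule bounded_linear.has_derivative[OF bounded_linear_vec_nth assms])

section \<open>Locality and components of partial derivatives\<close>

lemma partial_cong:
  assumes "open S" "x \<in> S" "\<And>z. z \<in> S \<Longrightarrow> f z = g z"
  shows "partial i f x = partial i g x"
proof -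
  \<comment> \<open>\<open>frechet_derivative\<close> is a choice among all derivatives. Both
    functions have the same derivatives at \<open>x\<close>, so the choices coincide, even if there
    is none.\<close>
  have "(f has_derivative f') (at x) \<longleftrightarrow> (g has_derivative f') (at x)" for f'
    using assms by (metis has_derivative_transform_within_open)
  then show ?thesis by (simp add: partial_def frechet_derivative_def)
qed

lemma differentiable_cong_open:
  assumes "open S" "x \<in> S" "\<And>z. z \<in> S \<Longrightarrow> f z = g z" "f differentiable (at x)"
  shows "g differentiable (at x)"
  using assms unfolding differentiable_def by (metis has_derivative_transform_within_open)

lemma Ck_on_cong:
  assumes "open S" "\<And>z. z \<in> S \<Longrightarrow> f z = g z" "Ck_on k S f"
  shows "Ck_on k S g"
  using assms(2,3)
proof (induction k arbitrary: f g)
  case 0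
  then show ?case using continuous_on_cong by fastforce
next
  case (Suc k)
  have "g differentiable (at x)" if "x \<in> S" for x
    using Suc.prems that assms(1) differentiable_cong_open[of S x f g] by simp
  moreover have "Ck_on k S (partial i g)" for i
    using Suc.IH[of "partial i f" "partial i g"] Suc.prems partial_cong[OF assms(1), of _ f g] by simp
  ultimately show ?case by simp
qed

lemma partial_vec_nth:
  fixes f :: "real^'m::finite \<Rightarrow> real^'k::finite"
  assumes "f differentiable (at x)"
  shows "partial i (\<lambda>z. f z $ c) x = partial i f x $ c"
  using partial_eqI[OF has_derivative_vec_nth[OF assms[unfolded frechet_derivative_works]]]
  by (simp add: partial_def)

lemma Ck_on_vec_nth:
  fixes f :: "real^'m::finite \<Rightarrow> real^'k::finite"
  assumes "open S" "Ck_on k S f"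
  shows "Ck_on k S (\<lambda>z. f z $ c)"
  using assms(2)
proof (induction k arbitrary: f)
  case 0
  then show ?case by (auto intro: continuous_on_component)
next
  case (Suc k)
  have "(\<lambda>z. f z $ c) differentiable (at x)" if "x \<in> S" for x
    using Suc.prems that has_derivative_vec_nth unfolding differentiable_def Ck_on.simps by blast
  moreover have "Ck_on k S (partial i (\<lambda>z. f z $ c))" for i
    by (rule Ck_on_cong[OF assms(1), of "\<lambda>z. partial i f z $ c"])
      (use Suc in \<open>auto simp: partial_vec_nth\<close>)
  ultimately show ?case by simp
qed

section \<open>Mixed partial derivatives through second differences\<close>

lemma has_real_derivative_partial_line:
  fixes f :: "real^'m::finite \<Rightarrow> real"
  assumes "f differentiable (at (x + t *\<^sub>R axis i 1))"
  shows "((\<lambda>t. f (x + t *\<^sub>R axis i 1)) has_real_derivative partial i f (x + t *\<^sub>R axis i 1)) (at t)"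
proof -
  let ?p = "x + t *\<^sub>R axis i 1"
  have "((\<lambda>t. x + t *\<^sub>R axis i 1) has_derivative (\<lambda>h. h *\<^sub>R axis i 1)) (at t)"
    by (auto intro!: derivative_eq_intros)
  from diff_chain_at[OF this assms[unfolded frechet_derivative_works]]
  have "((\<lambda>t. f (x + t *\<^sub>R axis i 1)) has_derivative
      (\<lambda>h. frechet_derivative f (at ?p) (h *\<^sub>R axis i 1))) (at t)"
    by (simp add: o_def)
  moreover have "frechet_derivative f (at ?p) (h *\<^sub>R axis i 1) = partial i f ?p * h" for h
    using linear_scale[OF linear_frechet_derivative[OF assms]] by (simp add: partial_def)
  ultimately show ?thesis by (simp add: has_field_derivative_def)
qed

text \<open>The mean value theorem is applied twice: along \<open>i\<close> to the increment of
  \<open>f\<close> in direction \<open>j\<close>, then along \<open>j\<close> to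
  \<open>partial i f\<close>. The points involved are moved by at most \<open>2 * s\<close>, which
  keeps them in the ball.\<close>

lemma second_difference_mvt:
  fixes f :: "real^'m::finite \<Rightarrow> real"
  assumes C: "Ck_on 2 (ball x r) f" and s: "0 < s" "2 * s < r"
  shows "\<exists>z\<in>ball x r. f (x + s *\<^sub>R axis i 1 + s *\<^sub>R axis j 1) - f (x + s *\<^sub>R axis i 1)
      - f (x + s *\<^sub>R axis j 1) + f x = s * s * partial j (partial i f) z"
proof -
  have C': "Ck_on (Suc (Suc 0)) (ball x r) f" using C by (simp add: numeral_2_eq_2)
  have inb: "x + a *\<^sub>R axis i 1 + c *\<^sub>R axis j 1 \<in> ball x r" if "0 \<le> a" "a \<le> s" "0 \<le> c" "c \<le> s" for a c
  proof -
    have "dist x (x + a *\<^sub>R axis i 1 + c *\<^sub>R axis j 1) = norm (a *\<^sub>R axis i 1 + c *\<^sub>R axis j 1 :: real^'m)"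
      by (metis add.assoc add_diff_cancel_left' dist_commute dist_norm)
    also have "\<dots> \<le> a + c"
      using norm_triangle_ineq[of "a *\<^sub>R axis i 1" "c *\<^sub>R axis j 1 :: real^'m"] that by simp
    finally show ?thesis using that s by simp
  qed
  have d0: "f differentiable (at z)" if "z \<in> ball x r" for z using C' that by simp
  have d1: "partial i f differentiable (at z)" if "z \<in> ball x r" for z using C' that by simp
  define g where "g = (\<lambda>a. f (x + s *\<^sub>R axis j 1 + a *\<^sub>R axis i 1) - f (x + a *\<^sub>R axis i 1))"
  have gd: "(g has_real_derivative partial i f (x + s *\<^sub>R axis j 1 + a *\<^sub>R axis i 1)
      - partial i f (x + a *\<^sub>R axis i 1)) (at a)" if "0 \<le> a" "a \<le> s" for a
    unfolding g_def
    by (intro DERIV_diff has_real_derivative_partial_line d0)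
      (use inb[of a s] inb[of a 0] that s in \<open>auto simp: algebra_simps\<close>)
  obtain a where a: "0 < a" "a < s" "g s - g 0 = (s - 0) * (partial i f (x + s *\<^sub>R axis j 1 + a *\<^sub>R axis i 1)
      - partial i f (x + a *\<^sub>R axis i 1))"
    using MVT2[OF s(1) gd] by blast
  define k where "k = (\<lambda>c. partial i f (x + a *\<^sub>R axis i 1 + c *\<^sub>R axis j 1))"
  have kd: "(k has_real_derivative partial j (partial i f) (x + a *\<^sub>R axis i 1 + c *\<^sub>R axis j 1)) (at c)"
    if "0 \<le> c" "c \<le> s" for c
    unfolding k_def by (intro has_real_derivative_partial_line d1) (use inb[of a c] that a in auto)
  obtain c where c: "0 < c" "c < s"
    "k s - k 0 = (s - 0) * partial j (partial i f) (x + a *\<^sub>R axis i 1 + c *\<^sub>R axis j 1)"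
    using MVT2[OF s(1) kd] by blast
  have "g s - g 0 = s * s * partial j (partial i f) (x + a *\<^sub>R axis i 1 + c *\<^sub>R axis j 1)"
    using a(3) c(3) by (simp add: k_def add_ac)
  moreover have "x + a *\<^sub>R axis i 1 + c *\<^sub>R axis j 1 \<in> ball x r" using inb a c by simp
  ultimately show ?thesis by (intro bexI) (auto simp: g_def add_ac)
qed

text \<open>The second difference is symmetric in \<open>i\<close> and \<open>j\<close>. Hence at
  every small scale the two mixed partials agree when taken at two suitable points near
  \<open>x\<close>, and continuity moves both points to \<open>x\<close>.\<close>

theorem partial_commute:
  fixes f :: "real^'m::finite \<Rightarrow> real"
  assumes S: "open S" "x \<in> S" and C: "Ck_on 2 S f"
  shows "partial i (partial j f) x = partial j (partial i f) x"
proof -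
  have mono: "Ck_on k T f" if "Ck_on k S f" "T \<subseteq> S" for k T and f :: "real^'m \<Rightarrow> real"
    using that by (induction k arbitrary: f) (auto intro: continuous_on_subset)
  have C': "Ck_on (Suc (Suc 0)) S f" using C by (simp add: numeral_2_eq_2)
  have "\<bar>partial i (partial j f) x - partial j (partial i f) x\<bar> \<le> e" if e: "e > 0" for e
  proof -
    have "\<exists>d>0. \<forall>z. dist z x < d \<longrightarrow> dist (partial i' (partial j' f) z) (partial i' (partial j' f) x) < e / 2" for i' j'
    proof -
      have "continuous (at x) (partial i' (partial j' f))"
        using C' S by (simp add: continuous_on_eq_continuous_at)
      then show ?thesis using e unfolding continuous_at_eps_delta by (meson half_gt_zero)
    qed
    note this[of i j] this[of j i]
    then obtain d1 d2 where d: "d1 > 0" "d2 > 0"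
      "\<And>z. dist z x < d1 \<Longrightarrow> dist (partial i (partial j f) z) (partial i (partial j f) x) < e / 2"
      "\<And>z. dist z x < d2 \<Longrightarrow> dist (partial j (partial i f) z) (partial j (partial i f) x) < e / 2"
      by metis
    obtain r0 where r0: "r0 > 0" "ball x r0 \<subseteq> S" using S open_contains_ball by blast
    define r where "r = min r0 (min d1 d2)"
    have r: "r > 0" "ball x r \<subseteq> S" "r \<le> d1" "r \<le> d2" using r0 d unfolding r_def by auto
    define s where "s = r / 3"
    have s: "0 < s" "2 * s < r" using r by (auto simp: s_def)
    have Cr: "Ck_on 2 (ball x r) f" using mono[OF C r(2)] .
    obtain z where z: "z \<in> ball x r" "f (x + s *\<^sub>R axis i 1 + s *\<^sub>R axis j 1) - f (x + s *\<^sub>R axis i 1)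
      - f (x + s *\<^sub>R axis j 1) + f x = s * s * partial j (partial i f) z"
      using second_difference_mvt[OF Cr s] by blast
    obtain z' where z': "z' \<in> ball x r" "f (x + s *\<^sub>R axis j 1 + s *\<^sub>R axis i 1) - f (x + s *\<^sub>R axis j 1)
      - f (x + s *\<^sub>R axis i 1) + f x = s * s * partial i (partial j f) z'"
      using second_difference_mvt[OF Cr s] by blast
    have "s * s * partial j (partial i f) z = s * s * partial i (partial j f) z'"
      unfolding z(2)[symmetric] z'(2)[symmetric] by (simp add: add_ac)
    then have "partial j (partial i f) z = partial i (partial j f) z'" using s by simp
    then show ?thesis
      using d(3)[of z'] d(4)[of z] z(1) z'(1) r
      by (simp add: dist_commute) (simp add: dist_real_def abs_if split: if_splits)
  qed
  then show ?thesis by (metis abs_le_zero_iff eq_iff_diff_eq_0 field_le_epsilon add_0)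
qed

section \<open>The spray in a moving frame\<close>

lemma linear_vec_expansion:
  fixes f :: "real^'m::finite \<Rightarrow> 'b::real_vector"
  assumes "linear f"
  shows "f w = (\<Sum>i\<in>UNIV. w $ i *\<^sub>R f (axis i 1))"
proof -
  interpret linear f by fact
  have "f w = f (\<Sum>i\<in>UNIV. w $ i *\<^sub>R axis i 1)"
    by (metis (no_types) basis_expansion scalar_mult_eq_scaleR)
  then show ?thesis by (simp add: sum scale)
qed

lemma matrix_inv_mult_eq:
  fixes G :: "real^'m::finite^'m"
  assumes "invertible G" "G *v u = v"
  shows "matrix_inv G *v v = u"
proof -
  have "matrix_inv G ** G = mat 1"
    using someI_ex[OF assms(1)[unfolded invertible_def]] unfolding matrix_inv_def by blast
  then show ?thesis by (metis assms(2) matrix_vector_mul_assoc matrix_vector_mul_lid)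
qed

text \<open>The first index of \<open>hessian\<close> belongs to the outer differentiation, so
  differentiating the gradient produces the transpose; symmetry removes it.\<close>

lemma hessian_mult_nth:
  assumes "\<And>i j. hessian L z $ i $ j = hessian L z $ j $ i"
    and "partial a L differentiable (at z)"
  shows "frechet_derivative (partial a L) (at z) q = (hessian L z *v q) $ a"
proof -
  have "frechet_derivative (partial a L) (at z) q
      = (\<Sum>i\<in>UNIV. q $ i *\<^sub>R frechet_derivative (partial a L) (at z) (axis i 1))"
    by (rule linear_vec_expansion) (rule linear_frechet_derivative[OF assms(2)])
  also have "\<dots> = (\<Sum>i\<in>UNIV. q $ i * hessian L z $ i $ a)"
    by (simp add: hessian_def partial_def[of _ "partial a L"])
  also have "\<dots> = (hessian L z *v q) $ a"
    by (simp add: matrix_vector_mult_def assms(1)[of _ a] mult.commute)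
  finally show ?thesis .
qed

lemma partial_lagrangian_velocity:
  fixes L :: "real^'m::finite \<Rightarrow> real" and N :: "real^'m \<Rightarrow> real^'m"
  assumes \<omega>: "open \<omega>" "N y \<in> \<omega>" and L: "L differentiable (at (N y))" and N: "linear N"
    and l: "\<And>y. N y \<in> \<omega> \<Longrightarrow> l y = L (N y)"
  shows "partial \<sigma> l y = (\<Sum>a\<in>UNIV. N (axis \<sigma> 1) $ a * partial a L (N y))"
proof -
  have bl: "bounded_linear N" using N by (rule linear_conv_bounded_linear[THEN iffD1])
  \<comment> \<open>\<open>l\<close> is known only where \<open>N y\<close> lies in
    \<open>\<omega>\<close>; as this region is open, the derivative sees nothing else.\<close>
  have op: "open (N -` \<omega>)"
    using \<omega>(1) bl by (simp add: linear_continuous_on open_vimage continuous_on_eq_continuous_at)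
  have "(L \<circ> N has_derivative (\<lambda>h. \<Sum>i\<in>UNIV. h $ i *\<^sub>R partial i L (N y)) \<circ> N) (at y)"
    by (intro diff_chain_at bounded_linear_imp_has_derivative bl has_derivative_sum_partial L)
  then have "partial \<sigma> (L \<circ> N) y = (\<Sum>a\<in>UNIV. N (axis \<sigma> 1) $ a * partial a L (N y))"
    by (simp add: partial_eqI)
  moreover have "partial \<sigma> l y = partial \<sigma> (L \<circ> N) y"
    by (rule partial_cong[OF op]) (use \<omega> l in auto)
  ultimately show ?thesis by simp
qed

text \<open>The spray of a Lagrangian \<open>L\<close> read off in a moving frame. Since
  \<open>N' y w - N' w y\<close> is the exterior derivative of the coframe, the hypothesis on \<open>q\<close> is the
  Euler-Lagrange equation with the velocity-quadratic term \<open>N' y y\<close> split off.\<close>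

lemma spray_moving_frame:
  fixes L :: "real^'m::finite \<Rightarrow> real" and N N' :: "real^'m \<Rightarrow> real^'m \<Rightarrow> real^'m"
  assumes S: "open S" "x0 \<in> S" and \<omega>: "open \<omega>" "N x0 y \<in> \<omega>"
    and L: "\<And>z. z \<in> \<omega> \<Longrightarrow> L differentiable (at z)"
      "\<And>z a. z \<in> \<omega> \<Longrightarrow> partial a L differentiable (at z)"
    and sym: "\<And>i j. hessian L (N x0 y) $ i $ j = hessian L (N x0 y) $ j $ i"
    and inv: "invertible (hessian L (N x0 y))"
    and lin: "\<And>x. x \<in> S \<Longrightarrow> linear (N x)"
    and der: "\<And>w. ((\<lambda>x. N x w) has_derivative (\<lambda>h. N' h w)) (at x0)"
    and M: "linear M" "\<And>w. M (N x0 w) = w" "\<And>w. N x0 (M w) = w"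
    and l: "\<And>x y. x \<in> S \<Longrightarrow> N x y \<in> \<omega> \<Longrightarrow> l x y = L (N x y)"
    and q: "\<And>w. (hessian L (N x0 y) *v q) \<bullet> N x0 w
        = (\<Sum>a\<in>UNIV. partial a L (N x0 y) * (N' y w $ a - N' w y $ a))"
  shows "spray l x0 y = (1/2) *\<^sub>R M (N' y y + q)"
proof -
  define z where "z = N x0 y"
  define H where "H = hessian L z"
  define G where "G = hessian (l x0) y"
  have z: "z \<in> \<omega>" using \<omega> by (simp add: z_def)
  have N0: "linear (N x0)" using lin S by simp
  have dL: "(partial a L has_derivative (\<lambda>h. (H *v h) $ a)) (at z)" for a
  proof -
    have "frechet_derivative (partial a L) (at z) = (\<lambda>h. (H *v h) $ a)"
      using hessian_mult_nth[OF sym, folded z_def] L(2)[OF z] by (simp add: H_def fun_eq_iff)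
    then show ?thesis using L(2)[OF z] frechet_derivative_works by metis
  qed
  \<comment> \<open>The spray also differentiates in \<open>x\<close> at fixed \<open>y\<close>, so
    the frame formulas are needed for all \<open>x\<close> near \<open>x0\<close>; continuity keeps
    \<open>N x y\<close> in \<open>\<omega>\<close>.\<close>
  have ev: "\<forall>\<^sub>F x in at x0. x \<in> S \<and> N x y \<in> \<omega>"
  proof -
    have "continuous (at x0) (\<lambda>x. N x y)" using der has_derivative_continuous by blast
    then have "\<forall>\<^sub>F x in at x0. N x y \<in> \<omega>"
      using \<omega> by (simp add: continuous_at topological_tendstoD)
    moreover have "\<forall>\<^sub>F x in at x0. x \<in> S" using S by (rule eventually_at_in_open')
    ultimately show ?thesis by eventually_elim simp
  qed
  have dl: "partial \<sigma> (l x) y' = (\<Sum>a\<in>UNIV. N x (axis \<sigma> 1) $ a * partial a L (N x y'))"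
    if "x \<in> S" "N x y' \<in> \<omega>" for x y' \<sigma>
    using partial_lagrangian_velocity[OF \<omega>(1), where N = "N x"] that L lin l by simp
  \<comment> \<open>The fibre Hessian is the pullback of \<open>H\<close> under the coframe, that
    is, N^T H N for the matrix N of \<open>N x0\<close>.\<close>
  have G_nth: "G $ \<mu> $ \<nu> = N x0 (axis \<nu> 1) \<bullet> (H *v N x0 (axis \<mu> 1))" for \<mu> \<nu>
  proof -
    have bl: "bounded_linear (N x0)" using N0 by (rule linear_conv_bounded_linear[THEN iffD1])
    have op: "open (N x0 -` \<omega>)"
      using \<omega>(1) bl by (simp add: linear_continuous_on open_vimage continuous_on_eq_continuous_at)
    have "partial \<mu> (partial \<nu> (l x0)) y
        = partial \<mu> (\<lambda>y. \<Sum>a\<in>UNIV. N x0 (axis \<nu> 1) $ a * partial a L (N x0 y)) y"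
      by (rule partial_cong[OF op]) (use \<omega> S dl in auto)
    also have "\<dots> = (\<Sum>a\<in>UNIV. N x0 (axis \<nu> 1) $ a * (H *v N x0 (axis \<mu> 1)) $ a)"
    proof (rule partial_eqI)
      have "((\<lambda>y. partial a L (N x0 y)) has_derivative (\<lambda>h. (H *v N x0 h) $ a)) (at y)" for a
        using diff_chain_at[OF bounded_linear_imp_has_derivative[OF bl] dL[unfolded z_def]]
        by (simp add: o_def)
      then show "((\<lambda>y. \<Sum>a\<in>UNIV. N x0 (axis \<nu> 1) $ a * partial a L (N x0 y)) has_derivative
          (\<lambda>h. \<Sum>a\<in>UNIV. N x0 (axis \<nu> 1) $ a * (H *v N x0 h) $ a)) (at y)"
        by (intro has_derivative_sum has_derivative_mult_right)
    qed
    finally show ?thesis by (simp add: G_def hessian_def inner_vec_def)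
  qed
  have Hsym: "u \<bullet> (H *v v) = v \<bullet> (H *v u)" for u v
  proof -
    have "transpose H = H" using sym by (simp add: transpose_def H_def z_def vec_eq_iff)
    then show ?thesis by (metis dot_lmul_matrix inner_commute transpose_matrix_vector)
  qed
  have G_mult: "(G *v u) \<bullet> w = N x0 w \<bullet> (H *v N x0 u)" for u w
  proof -
    have "(G *v u) $ \<mu> = N x0 (axis \<mu> 1) \<bullet> (H *v N x0 u)" for \<mu>
    proof -
      have "N x0 u \<bullet> (H *v N x0 (axis \<mu> 1)) = (\<Sum>\<nu>\<in>UNIV. u $ \<nu> * G $ \<mu> $ \<nu>)"
        by (subst linear_vec_expansion[OF N0, of u]) (simp add: G_nth inner_sum_left)
      moreover have "(G *v u) $ \<mu> = (\<Sum>\<nu>\<in>UNIV. u $ \<nu> * G $ \<mu> $ \<nu>)"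
        by (simp add: matrix_vector_mult_def mult.commute)
      ultimately show ?thesis using Hsym[of "N x0 (axis \<mu> 1)"] by simp
    qed
    then have "(G *v u) \<bullet> w = (\<Sum>\<mu>\<in>UNIV. w $ \<mu> *\<^sub>R N x0 (axis \<mu> 1)) \<bullet> (H *v N x0 u)"
      by (simp add: inner_vec_def[of "G *v u"] inner_sum_left mult.commute)
    then show ?thesis by (simp flip: linear_vec_expansion[OF N0])
  qed
  have "invertible G"
  proof -
    have "u = 0" if "G *v u = 0" for u
    proof -
      have "v \<bullet> (H *v N x0 u) = 0" for v using G_mult[of u "M v"] that M by simp
      then have "H *v N x0 u = 0" by (metis inner_eq_zero_iff)
      then have "N x0 u = 0"
        using inv by (metis H_def z_def matrix_inv_mult_eq matrix_vector_mult_0_right)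
      then show ?thesis using M linear_0 by metis
    qed
    then show ?thesis by (metis invertible_left_inverse matrix_left_invertible_ker)
  qed
  define X where "X \<sigma> = (\<Sum>\<rho>\<in>UNIV. partial \<rho> (\<lambda>x'. partial \<sigma> (l x') y) x0 * y $ \<rho>)
          - partial \<sigma> (\<lambda>x'. l x' y) x0" for \<sigma>
  \<comment> \<open>\<open>X\<close> is the Euler-Lagrange expression. Differentiating the momentum
    along \<open>y\<close> gives a Hessian term in \<open>N' y y\<close> and a term in
    \<open>N' y\<close> of a basis vector. Subtracting the position derivative of \<open>l\<close>
    turns the latter into the exterior derivative of the coframe, which the hypothesis on
    \<open>q\<close> rewrites as a second Hessian term.\<close>
  have X: "X \<sigma> = (G *v M (N' y y + q)) $ \<sigma>" for \<sigma>
  proof -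
    define f where "f = (\<lambda>x. \<Sum>a\<in>UNIV. N x (axis \<sigma> 1) $ a * partial a L (N x y))"
    define f' where "f' = (\<lambda>h. \<Sum>a\<in>UNIV. N x0 (axis \<sigma> 1) $ a * (H *v N' h y) $ a
        + N' h (axis \<sigma> 1) $ a * partial a L z)"
    have "(f has_derivative f') (at x0)"
      unfolding f_def f'_def z_def
      by (intro has_derivative_sum has_derivative_mult has_derivative_vec_nth der
          diff_chain_at[OF der dL[unfolded z_def], unfolded o_def])
    then have f': "((\<lambda>x'. partial \<sigma> (l x') y) has_derivative f') (at x0)"
      by (rule has_derivative_transform_eventually)
        (use ev dl S \<omega> in \<open>auto simp: f_def elim: eventually_mono\<close>)
    have "(\<Sum>\<rho>\<in>UNIV. partial \<rho> (\<lambda>x'. partial \<sigma> (l x') y) x0 * y $ \<rho>) = f' y"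
      using linear_vec_expansion[OF has_derivative_linear[OF f'], of y]
      by (simp add: partial_eqI[OF f'] mult.commute)
    moreover have "partial \<sigma> (\<lambda>x'. l x' y) x0 = (\<Sum>a\<in>UNIV. N' (axis \<sigma> 1) y $ a * partial a L z)"
    proof -
      have "((\<lambda>x. L (N x y)) has_derivative (\<lambda>h. \<Sum>a\<in>UNIV. N' h y $ a *\<^sub>R partial a L z)) (at x0)"
        unfolding z_def
        by (rule diff_chain_at[OF der has_derivative_sum_partial, unfolded o_def]) (rule L(1)[OF \<omega>(2)])
      then have "((\<lambda>x'. l x' y) has_derivative (\<lambda>h. \<Sum>a\<in>UNIV. N' h y $ a *\<^sub>R partial a L z)) (at x0)"
        by (rule has_derivative_transform_eventually)
          (use ev l S \<omega> in \<open>auto elim: eventually_mono\<close>)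
      from partial_eqI[OF this] show ?thesis by simp
    qed
    ultimately have "X \<sigma> = N x0 (axis \<sigma> 1) \<bullet> (H *v N' y y)
        + (\<Sum>a\<in>UNIV. partial a L z * (N' y (axis \<sigma> 1) $ a - N' (axis \<sigma> 1) y $ a))"
      by (simp add: X_def f'_def inner_vec_def sum.distrib sum_subtractf right_diff_distrib mult.commute)
    also have "\<dots> = N x0 (axis \<sigma> 1) \<bullet> (H *v (N' y y + q))"
      using q[of "axis \<sigma> 1", folded z_def, folded H_def]
      by (simp add: matrix_vector_right_distrib inner_add_right inner_commute)
    also have "\<dots> = (G *v M (N' y y + q)) $ \<sigma>"
      using G_mult[of "M (N' y y + q)" "axis \<sigma> 1"] M by (simp add: inner_axis)
    finally show ?thesis .
  qed
  have "spray l x0 y = (1/2) *\<^sub>R (matrix_inv G *v (\<chi> \<sigma>. X \<sigma>))"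
    by (simp add: spray_def X_def G_def matrix_vector_mult_def vec_eq_iff)
  moreover have "matrix_inv G *v (\<chi> \<sigma>. X \<sigma>) = M (N' y y + q)"
    by (rule matrix_inv_mult_eq[OF \<open>invertible G\<close>]) (simp add: vec_eq_iff X)
  ultimately show ?thesis by simp
qed

section \<open>Derivatives of the Bogoslovsky Lagrangian\<close>

lemma sum_UNIV_numbering:
  fixes n :: nat and f :: "'m::finite \<Rightarrow> 'a::comm_monoid_add"
  assumes "1 \<le> n" and ix: "bij_betw ix {0..n} (UNIV :: 'm set)"
  shows "(\<Sum>k\<in>UNIV. f k) = f (ix 0) + (\<Sum>i\<in>{1..<n}. f (ix i)) + f (ix n)"
proof -
  have "(\<Sum>k\<in>UNIV. f k) = (\<Sum>i\<in>{0..n}. f (ix i))"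
    using sum.reindex_bij_betw[OF ix] by metis
  also have "{0..n} = insert 0 (insert n {1..<n})" using assms(1) by auto
  finally show ?thesis using assms(1) by (simp add: add_ac)
qed

lemma numbering_cases:
  fixes n :: nat
  assumes "1 \<le> n" and ix: "bij_betw ix {0..n} (UNIV :: 'm set)"
  obtains "k = ix 0" | "k = ix n" | i where "i \<in> {1..<n}" "k = ix i"
proof -
  obtain a where "a \<le> n" "k = ix a" using ix by (metis UNIV_I atLeastAtMost_iff bij_betw_iff_bijections)
  then consider "a = 0" | "a = n" | "a \<in> {1..<n}" by force
  then show ?thesis using that \<open>k = ix a\<close> by cases auto
qed

lemma numbering_eq_iff:
  fixes n :: nat
  assumes "bij_betw ix {0..n} (UNIV :: 'm set)" "i \<le> n" "j \<le> n"
  shows "ix i = ix j \<longleftrightarrow> i = j"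
  using assms by (auto simp: bij_betw_def inj_on_def)

text \<open>The Minkowski metric in light-cone coordinates, of signature (-,+,...,+); it is the
  polar form of -Q.\<close>

definition bogoslovsky_eta :: "nat \<Rightarrow> (nat \<Rightarrow> 'm::finite) \<Rightarrow> real^'m \<Rightarrow> real^'m \<Rightarrow> real" where
  "bogoslovsky_eta n ix z h =
     (\<Sum>i\<in>{1..<n}. z $ ix i * h $ ix i) - z $ ix 0 * h $ ix n - z $ ix n * h $ ix 0"

text \<open>On the cone this is -2 times the derivative of \<open>L\<close> with respect to Q at
  fixed z^0.\<close>

definition bogoslovsky_P :: "nat \<Rightarrow> (nat \<Rightarrow> 'm::finite) \<Rightarrow> real \<Rightarrow> real^'m \<Rightarrow> real" where
  "bogoslovsky_P n ix b z = (1 - b) * bogoslovsky_Q n ix z powr (- b) * z $ ix 0 powr (2 * b)"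

text \<open>On the cone, \<open>dL = P \<eta>(z, -) + (w P Q / z\<^sup>0) dz\<^sup>0\<close> with \<open>w = - b / (1 - b)\<close>; the product
  \<open>w P\<close> is written out so that \<open>b = 1\<close> is covered.\<close>

definition bogoslovsky_T :: "nat \<Rightarrow> (nat \<Rightarrow> 'm::finite) \<Rightarrow> real \<Rightarrow> real^'m \<Rightarrow> real" where
  "bogoslovsky_T n ix b z = - b * bogoslovsky_Q n ix z powr (1 - b) * z $ ix 0 powr (2 * b - 1)"

lemma has_derivative_bogoslovsky_Q:
  "(bogoslovsky_Q n ix has_derivative (\<lambda>h. - 2 * bogoslovsky_eta n ix z h)) (at z)"
  unfolding bogoslovsky_Q_def[abs_def] bogoslovsky_eta_def
  by (auto intro!: derivative_eq_intros has_derivative_vec_nth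
      simp: algebra_simps sum_distrib_left sum_negf power2_eq_square)

lemma powr_minus_one: "x powr (a - 1) = x powr a / x" if "0 < x" for x :: real
  using that by (simp add: powr_diff)

lemma bogoslovsky_L_eq:
  "bogoslovsky_L n ix b z
    = - (1/2) * (bogoslovsky_Q n ix z powr (1 - b) * z $ ix 0 powr (2 * b))"
proof -
  have "(x powr (r / 2))\<^sup>2 = x powr r" for x r :: real
    by (simp add: power2_eq_square flip: powr_add)
  from this[of _ "1 - b"] this[of _ "2 * b"] show ?thesis
    by (simp only: bogoslovsky_L_def bogoslovsky_F_def power_mult_distrib) simp
qed

context
  fixes n :: nat and ix :: "nat \<Rightarrow> 'm::finite" and b :: real and z :: "real^'m"
  assumes z: "z \<in> bogoslovsky_cone n ix"
begin

lemma cone_pos: "0 < bogoslovsky_Q n ix z" "0 < z $ ix 0"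
  using z by (auto simp: bogoslovsky_cone_def)

text \<open>\<open>L\<close>, \<open>P\<close> and \<open>T\<close> are all monomials in real powers
  of Q and z^0, so one logarithmic derivative serves all three.\<close>

lemma has_derivative_powr_monomial:
  "((\<lambda>z. c * bogoslovsky_Q n ix z powr r * z $ ix 0 powr s) has_derivative
     (\<lambda>h. c * bogoslovsky_Q n ix z powr r * z $ ix 0 powr s *
        (s * h $ ix 0 / z $ ix 0 - 2 * r * bogoslovsky_eta n ix z h / bogoslovsky_Q n ix z))) (at z)"
  using cone_pos
  by (auto intro!: derivative_eq_intros has_derivative_vec_nth has_derivative_bogoslovsky_Q
      simp: fun_eq_iff field_simps powr_minus_one)

end

lemma bogoslovsky_L_has_derivative:
  assumes "open (bogoslovsky_cone n ix)" "z \<in> bogoslovsky_cone n ix"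
  shows "(bogoslovsky_L n ix b has_derivative
    (\<lambda>h. bogoslovsky_P n ix b z * bogoslovsky_eta n ix z h + bogoslovsky_T n ix b z * h $ ix 0)) (at z)"
proof (rule has_derivative_transform_within_open[OF _ assms])
  show "((\<lambda>z. - (1/2) * bogoslovsky_Q n ix z powr (1 - b) * z $ ix 0 powr (2 * b)) has_derivative
    (\<lambda>h. bogoslovsky_P n ix b z * bogoslovsky_eta n ix z h + bogoslovsky_T n ix b z * h $ ix 0)) (at z)"
    by (rule has_derivative_eq_rhs[OF has_derivative_powr_monomial[OF assms(2)]])
      (use cone_pos[OF assms(2)] in \<open>auto simp: fun_eq_iff bogoslovsky_P_def bogoslovsky_T_def
        powr_diff powr_minus field_simps\<close>)
qed (simp add: bogoslovsky_L_eq)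

lemma partial_bogoslovsky_L:
  assumes "open (bogoslovsky_cone n ix)" "z \<in> bogoslovsky_cone n ix"
  shows "partial a (bogoslovsky_L n ix b) z =
    bogoslovsky_P n ix b z * bogoslovsky_eta n ix z (axis a 1) + bogoslovsky_T n ix b z * axis a 1 $ ix 0"
  using partial_eqI[OF bogoslovsky_L_has_derivative[OF assms]] .

text \<open>The two long factors are the logarithmic derivatives of \<open>P\<close> and
  \<open>T\<close> along \<open>q\<close>. They are kept as units because the quadratic solution
  turns each of them into a constant times z^0.\<close>

lemma partial_bogoslovsky_L_has_derivative:
  assumes "open (bogoslovsky_cone n ix)" "z \<in> bogoslovsky_cone n ix"
  defines "Q \<equiv> bogoslovsky_Q n ix z" and "\<eta> \<equiv> bogoslovsky_eta n ix"
  shows "(partial a (bogoslovsky_L n ix b) has_derivative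
    (\<lambda>q. bogoslovsky_P n ix b z * (\<eta> q (axis a 1) +
           (2 * b * q $ ix 0 / z $ ix 0 + 2 * b * \<eta> z q / Q) * \<eta> z (axis a 1))
       + bogoslovsky_T n ix b z * ((2 * b - 1) * q $ ix 0 / z $ ix 0 - 2 * (1 - b) * \<eta> z q / Q)
           * axis a 1 $ ix 0)) (at z)"
proof (rule has_derivative_transform_within_open[OF _ assms(1,2)])
  have \<eta>: "((\<lambda>z. \<eta> z (axis a 1)) has_derivative (\<lambda>q. \<eta> q (axis a 1))) (at z)"
    unfolding \<eta>_def bogoslovsky_eta_def
    by (auto intro!: derivative_eq_intros has_derivative_vec_nth)
  have P: "(bogoslovsky_P n ix b has_derivative (\<lambda>q. bogoslovsky_P n ix b z *
      (2 * b * q $ ix 0 / z $ ix 0 + 2 * b * \<eta> z q / Q))) (at z)"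
    using has_derivative_powr_monomial[OF assms(2), of "1 - b" "- b" "2 * b"]
    by (simp add: bogoslovsky_P_def[abs_def] \<eta>_def Q_def)
  have T: "(bogoslovsky_T n ix b has_derivative (\<lambda>q. bogoslovsky_T n ix b z *
      ((2 * b - 1) * q $ ix 0 / z $ ix 0 - 2 * (1 - b) * \<eta> z q / Q))) (at z)"
    using has_derivative_powr_monomial[OF assms(2), of "- b" "1 - b" "2 * b - 1"]
    by (simp add: bogoslovsky_T_def[abs_def] \<eta>_def Q_def)
  show "((\<lambda>z. bogoslovsky_P n ix b z * \<eta> z (axis a 1) + bogoslovsky_T n ix b z * axis a 1 $ ix 0)
    has_derivative (\<lambda>q. bogoslovsky_P n ix b z * (\<eta> q (axis a 1) +
           (2 * b * q $ ix 0 / z $ ix 0 + 2 * b * \<eta> z q / Q) * \<eta> z (axis a 1))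
       + bogoslovsky_T n ix b z * ((2 * b - 1) * q $ ix 0 / z $ ix 0 - 2 * (1 - b) * \<eta> z q / Q)
           * axis a 1 $ ix 0)) (at z)"
    by (rule has_derivative_eq_rhs[OF has_derivative_add[OF has_derivative_mult[OF P \<eta>]
          has_derivative_mult_left[OF T]]]) (simp add: fun_eq_iff algebra_simps)
qed (simp add: partial_bogoslovsky_L assms(1) \<eta>_def)

section \<open>The Bogoslovsky Hessian and the excluded parameters\<close>

lemma Ck_on_Suc_imp: "Ck_on (Suc k) S f \<Longrightarrow> Ck_on k S f"
proof (induction k arbitrary: f)
  case 0
  then show ?case
    by (auto intro!: continuous_at_imp_continuous_on differentiable_imp_continuous_within)
next
  case (Suc k)
  then show ?case by (metis Ck_on.simps(2))
qed

lemma Ck_on_le: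
  assumes "Ck_on k S f" "j \<le> k"
  shows "Ck_on j S f"
  using assms(2,1) by (induction rule: inc_induct) (auto intro: Ck_on_Suc_imp)

lemma hessian_symmetric:
  assumes "open S" "z \<in> S" "Ck_on 2 S L"
  shows "hessian L z $ i $ j = hessian L z $ j $ i"
  using partial_commute[OF assms] by (simp add: hessian_def)

context
  fixes n :: nat and ix :: "nat \<Rightarrow> 'm::finite"
  assumes n: "1 \<le> n" and ix: "bij_betw ix {0..n} (UNIV :: 'm set)"
begin

lemma bogoslovsky_eta_linear: "linear (bogoslovsky_eta n ix z)"
  by (rule linearI) (simp_all add: bogoslovsky_eta_def algebra_simps sum.distrib sum_distrib_left)

lemma bogoslovsky_eta_commute: "bogoslovsky_eta n ix z h = bogoslovsky_eta n ix h z"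
  by (simp add: bogoslovsky_eta_def mult.commute)

lemma bogoslovsky_eta_self: "bogoslovsky_eta n ix z z = - bogoslovsky_Q n ix z"
  by (simp add: bogoslovsky_eta_def bogoslovsky_Q_def power2_eq_square)

lemma numbering_distinct:
  "ix 0 \<noteq> ix n" "ix n \<noteq> ix 0"
  "i \<in> {1..<n} \<Longrightarrow> ix i \<noteq> ix 0" "i \<in> {1..<n} \<Longrightarrow> ix 0 \<noteq> ix i"
  "i \<in> {1..<n} \<Longrightarrow> ix i \<noteq> ix n" "i \<in> {1..<n} \<Longrightarrow> ix n \<noteq> ix i"
  using n by (auto simp: numbering_eq_iff[OF ix])

lemma bogoslovsky_eta_axis:
  "bogoslovsky_eta n ix z (axis (ix 0) 1) = - z $ ix n"
  "bogoslovsky_eta n ix z (axis (ix n) 1) = - z $ ix 0"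
  "i \<in> {1..<n} \<Longrightarrow> bogoslovsky_eta n ix z (axis (ix i) 1) = z $ ix i"
proof -
  show "bogoslovsky_eta n ix z (axis (ix 0) 1) = - z $ ix n"
    using numbering_distinct by (simp add: bogoslovsky_eta_def axis_def)
  show "bogoslovsky_eta n ix z (axis (ix n) 1) = - z $ ix 0"
    using numbering_distinct by (simp add: bogoslovsky_eta_def axis_def)
  assume i: "i \<in> {1..<n}"
  have "(\<Sum>j\<in>{1..<n}. z $ ix j * axis (ix i) 1 $ ix j) = (\<Sum>j\<in>{1..<n}. if j = i then z $ ix j else 0)"
    by (rule sum.cong) (use i in \<open>auto simp: axis_def numbering_eq_iff[OF ix]\<close>)
  then show "bogoslovsky_eta n ix z (axis (ix i) 1) = z $ ix i"
    using i numbering_distinct by (simp add: bogoslovsky_eta_def axis_def)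
qed

text \<open>The relation T = w P Q / z^0 cleared of denominators, so that \<open>b = 1\<close> is
  covered.\<close>

lemma bogoslovsky_T_P:
  assumes "z \<in> bogoslovsky_cone n ix"
  shows "(1 - b) * bogoslovsky_T n ix b z * z $ ix 0 = - b * bogoslovsky_P n ix b z * bogoslovsky_Q n ix z"
  using cone_pos[OF assms]
  by (simp add: bogoslovsky_P_def bogoslovsky_T_def powr_diff powr_minus field_simps)

context
  fixes b :: real
  assumes pm: "pseudo_minkowski (bogoslovsky_cone n ix) (bogoslovsky_L n ix b)"
begin

lemma cone_open: "open (bogoslovsky_cone n ix)"
  using pm by (simp add: pseudo_minkowski_def)

lemma bogoslovsky_hessian_symmetric:
  assumes "z \<in> bogoslovsky_cone n ix"
  shows "hessian (bogoslovsky_L n ix b) z $ i $ j = hessian (bogoslovsky_L n ix b) z $ j $ i"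
  using pm assms by (intro hessian_symmetric[OF cone_open assms])
    (auto simp: pseudo_minkowski_def intro: Ck_on_le)

lemma bogoslovsky_hessian_mult:
  assumes "z \<in> bogoslovsky_cone n ix"
  shows "(hessian (bogoslovsky_L n ix b) z *v q) $ a =
    bogoslovsky_P n ix b z * (bogoslovsky_eta n ix q (axis a 1) +
       (2 * b * q $ ix 0 / z $ ix 0 + 2 * b * bogoslovsky_eta n ix z q / bogoslovsky_Q n ix z)
         * bogoslovsky_eta n ix z (axis a 1))
    + bogoslovsky_T n ix b z * ((2 * b - 1) * q $ ix 0 / z $ ix 0
       - 2 * (1 - b) * bogoslovsky_eta n ix z q / bogoslovsky_Q n ix z) * axis a 1 $ ix 0"
proof -
  note d = partial_bogoslovsky_L_has_derivative[OF cone_open assms, of a b]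
  have "partial a (bogoslovsky_L n ix b) differentiable (at z)"
    using d by (rule differentiableI)
  from hessian_mult_nth[OF bogoslovsky_hessian_symmetric[OF assms] this]
  show ?thesis by (simp add: frechet_derivative_at[OF d, symmetric])
qed

text \<open>At the excluded values the Hessian kills \<open>\<partial>\<^sub>n\<close>, respectively
  \<open>z - (Q / (2 z\<^sup>0)) \<partial>\<^sub>n\<close>.\<close>

lemma bogoslovsky_parameter: "b \<noteq> 1" "b \<noteq> -1"
proof -
  obtain z where z: "z \<in> bogoslovsky_cone n ix" and inv: "invertible (hessian (bogoslovsky_L n ix b) z)"
    using pm by (auto simp: pseudo_minkowski_def)
  note pos = cone_pos[OF z]
  have ker: "q = 0" if "\<And>a. (hessian (bogoslovsky_L n ix b) z *v q) $ a = 0" for q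
    using matrix_inv_mult_eq[OF inv, of q 0] that by (simp add: vec_eq_iff)
  show "b \<noteq> 1"
  proof
    assume b: "b = 1"
    \<comment> \<open>For \<open>b = 1\<close> the Lagrangian depends on z^0 alone on the cone, so
      its gradient is constant along the last axis.\<close>
    have "axis (ix n) 1 = (0 :: real^'m)"
      by (rule ker, unfold bogoslovsky_hessian_mult[OF z])
        (use numbering_distinct in \<open>simp add: b bogoslovsky_P_def axis_def\<close>)
    then show False by simp
  qed
  show "b \<noteq> -1"
  proof
    assume b: "b = -1"
    \<comment> \<open>This \<open>c\<close> gives \<eta>(z, q) = -Q/2, so that for
      \<open>b = -1\<close> the logarithmic derivatives of \<open>P\<close> and \<open>T\<close>
      along \<open>q\<close> both equal -1. What remains of the \<open>P\<close> part is P c dz^0,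
      and it cancels against T dz^0.\<close>
    define c where "c = bogoslovsky_Q n ix z / (2 * z $ ix 0)"
    define q where "q = z - c *\<^sub>R axis (ix n) 1"
    have q0: "q $ ix 0 = z $ ix 0" using numbering_distinct by (simp add: q_def axis_def)
    have zq: "bogoslovsky_eta n ix z q = - bogoslovsky_Q n ix z / 2"
      using pos by (simp add: q_def c_def linear_diff[OF bogoslovsky_eta_linear]
          linear_scale[OF bogoslovsky_eta_linear] bogoslovsky_eta_axis bogoslovsky_eta_self)
    have qh: "bogoslovsky_eta n ix q h = bogoslovsky_eta n ix z h + c * h $ ix 0" for h
      by (simp add: q_def bogoslovsky_eta_commute[of _ h] linear_diff[OF bogoslovsky_eta_linear]
          linear_scale[OF bogoslovsky_eta_linear] bogoslovsky_eta_axis)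
    have T: "bogoslovsky_T n ix b z = bogoslovsky_P n ix b z * c"
      using bogoslovsky_T_P[OF z, of b] pos by (simp add: b c_def field_simps)
    have "q = 0"
      by (rule ker, unfold bogoslovsky_hessian_mult[OF z] q0 zq qh T)
        (use pos in \<open>simp add: b algebra_simps\<close>)
    then show False using q0 pos by simp
  qed
qed

end
end

section \<open>Quadratic solution of the frame equation\<close>

text \<open>Required on the whole space rather than on a cone, which makes the notion stable under
  linear substitutions; the Berwald property only uses its restriction to a fibre.\<close>

definition quadratic :: "(real^'m::finite \<Rightarrow> real) \<Rightarrow> bool" where
  "quadratic f \<longleftrightarrow> (\<exists>\<Gamma>. \<forall>y. f y = (\<Sum>\<alpha>\<in>UNIV. \<Sum>\<beta>\<in>UNIV. \<Gamma> \<alpha> \<beta> * y $ \<alpha> * y $ \<beta>))"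

lemma quadratic_linear_mult:
  fixes f g :: "real^'m::finite \<Rightarrow> real"
  assumes "linear f" "linear g"
  shows "quadratic (\<lambda>y. f y * g y)"
  unfolding quadratic_def
proof (intro exI allI)
  fix y
  have "f y * g y = (\<Sum>\<alpha>\<in>UNIV. y $ \<alpha> *\<^sub>R f (axis \<alpha> 1)) * (\<Sum>\<beta>\<in>UNIV. y $ \<beta> *\<^sub>R g (axis \<beta> 1))"
    using linear_vec_expansion[OF assms(1), of y] linear_vec_expansion[OF assms(2), of y] by simp
  then show "f y * g y = (\<Sum>\<alpha>\<in>UNIV. \<Sum>\<beta>\<in>UNIV. (f (axis \<alpha> 1) * g (axis \<beta> 1)) * y $ \<alpha> * y $ \<beta>)"
    by (simp add: sum_product mult_ac)
qed

lemma quadratic_add: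
  assumes "quadratic f" "quadratic g"
  shows "quadratic (\<lambda>y. f y + g y)"
proof -
  obtain \<Gamma> where \<Gamma>: "\<And>y. f y = (\<Sum>\<alpha>\<in>UNIV. \<Sum>\<beta>\<in>UNIV. \<Gamma> \<alpha> \<beta> * y $ \<alpha> * y $ \<beta>)"
    using assms(1) unfolding quadratic_def by blast
  obtain \<Gamma>' where \<Gamma>': "\<And>y. g y = (\<Sum>\<alpha>\<in>UNIV. \<Sum>\<beta>\<in>UNIV. \<Gamma>' \<alpha> \<beta> * y $ \<alpha> * y $ \<beta>)"
    using assms(2) unfolding quadratic_def by blast
  show ?thesis unfolding quadratic_def
    by (intro exI[of _ "\<lambda>\<alpha> \<beta>. \<Gamma> \<alpha> \<beta> + \<Gamma>' \<alpha> \<beta>"]) (simp add: \<Gamma> \<Gamma>' distrib_right sum.distrib)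
qed

lemma quadratic_cmult:
  assumes "quadratic f"
  shows "quadratic (\<lambda>y. c * f y)"
proof -
  obtain \<Gamma> where "\<And>y. f y = (\<Sum>\<alpha>\<in>UNIV. \<Sum>\<beta>\<in>UNIV. \<Gamma> \<alpha> \<beta> * y $ \<alpha> * y $ \<beta>)"
    using assms(1) unfolding quadratic_def by blast
  then show ?thesis unfolding quadratic_def
    by (intro exI[of _ "\<lambda>\<alpha> \<beta>. c * \<Gamma> \<alpha> \<beta>"]) (simp add: sum_distrib_left mult.assoc)
qed

lemma quadratic_diff:
  assumes "quadratic f" "quadratic g"
  shows "quadratic (\<lambda>y. f y - g y)"
  using quadratic_add[OF assms(1) quadratic_cmult[OF assms(2), of "-1"]] by simp

lemma quadratic_sum:
  assumes "\<And>i. i \<in> I \<Longrightarrow> quadratic (f i)"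
  shows "quadratic (\<lambda>y. \<Sum>i\<in>I. f i y)"
proof -
  have "quadratic (\<lambda>y. 0)" unfolding quadratic_def by (intro exI[of _ "\<lambda>_ _. 0"]) simp
  with assms show ?thesis by (induction I rule: infinite_finite_induct) (auto intro: quadratic_add)
qed

lemma linear_vec_nth: "linear (\<lambda>x :: real^'m::finite. x $ i)"
  by (simp add: linear_iff)

lemma linear_compose_vec_nth:
  fixes M :: "'a::real_vector \<Rightarrow> real^'m::finite"
  shows "linear M \<Longrightarrow> linear (\<lambda>x. M x $ i)"
  by (simp add: linear_iff)

lemma quadratic_linear_compose:
  fixes M :: "real^'k::finite \<Rightarrow> real^'m::finite"
  assumes "quadratic f" and M: "linear M"
  shows "quadratic (\<lambda>y. f (M y))"
proof -
  obtain \<Gamma> where \<Gamma>: "\<And>y. f y = (\<Sum>\<alpha>\<in>UNIV. \<Sum>\<beta>\<in>UNIV. \<Gamma> \<alpha> \<beta> * y $ \<alpha> * y $ \<beta>)"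
    using assms(1) unfolding quadratic_def by blast
  show ?thesis unfolding \<Gamma> mult.assoc
    by (intro quadratic_sum quadratic_cmult quadratic_linear_mult linear_compose_vec_nth M)
qed

text \<open>The coframe equations of the theorem in invariant form: \<open>C\<close> is the exterior derivative of the
  coframe, expressed in the frame itself.\<close>

lemma bogoslovsky_quadratic_solution:
  fixes n :: nat and ix :: "nat \<Rightarrow> 'm::finite" and b :: real
    and C :: "real^'m \<Rightarrow> real^'m \<Rightarrow> real^'m"
  assumes n: "1 \<le> n" and ix: "bij_betw ix {0..n} (UNIV :: 'm set)"
    and pm: "pseudo_minkowski (bogoslovsky_cone n ix) (bogoslovsky_L n ix b)"
    and lin1: "\<And>w. linear (\<lambda>z. C z w)" and anti: "\<And>z w. C z w = - C w z"
    and C0: "\<And>z w. C z w $ ix 0 = 0"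
    and Ci: "\<And>z i. i \<in> {1..<n} \<Longrightarrow> C z (axis (ix n) 1) $ ix i = 0"
    and Cn: "\<And>z. z $ ix 0 = 0 \<Longrightarrow> C z (axis (ix n) 1) $ ix n = 0"
  obtains q :: "real^'m \<Rightarrow> real^'m" where "\<And>k. quadratic (\<lambda>z. q z $ k)"
    "\<And>z w. z \<in> bogoslovsky_cone n ix \<Longrightarrow>
      (hessian (bogoslovsky_L n ix b) z *v q z) \<bullet> w = (\<Sum>a\<in>UNIV. partial a (bogoslovsky_L n ix b) z * C z w $ a)"
proof -
  note sumU = sum_UNIV_numbering[OF n ix]
  note dist = numbering_distinct[OF n ix]
  note ax = bogoslovsky_eta_axis[OF n ix]
  have lin2: "linear (C z)" for z
  proof -
    have "C z = (\<lambda>w. - C w z)" by (rule ext) (rule anti)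
    then show ?thesis using lin1[of z] by (simp add: linear_compose_neg)
  qed
  \<comment> \<open>As \<open>C z w\<close> has no component at \<open>ix 0\<close>, this is
    \<eta>(z, C z w), and the right-hand side of the equation is \<open>P\<close> times it.\<close>
  define r where "r z w = (\<Sum>i\<in>{1..<n}. z $ ix i * C z w $ ix i) - z $ ix 0 * C z w $ ix n" for z w
  have r_lin: "linear (r z)" for z
    using lin2[of z] unfolding r_def linear_iff
    by (simp add: algebra_simps sum.distrib sum_distrib_left)
  have r_quad: "quadratic (\<lambda>z. r z w)" for w
    unfolding r_def
    by (intro quadratic_diff quadratic_sum quadratic_linear_mult linear_vec_nth linear_compose_vec_nth lin1)
  have r_self: "r z z = 0" for z
  proof -
    have "C z z $ k = 0" for k using arg_cong[OF anti[of z z], of "\<lambda>v. v $ k"] by simp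
    then show ?thesis by (simp add: r_def)
  qed
  define lam where "lam = C (axis (ix n) 1) (axis (ix 0) 1) $ ix n"
  \<comment> \<open>Subtracting from \<open>z\<close> its \<open>ix 0\<close> component makes
    \<open>Cn\<close> applicable, so C^n(z, e_n) is linear in z^0 alone; the prefactor z^0 in
    \<open>r\<close> gives the square.\<close>
  have rn: "r z (axis (ix n) 1) = lam * (z $ ix 0)\<^sup>2" for z
  proof -
    have "C (z - z $ ix 0 *\<^sub>R axis (ix 0) 1) (axis (ix n) 1) $ ix n = 0" by (rule Cn) simp
    moreover have "C (axis (ix 0) 1) (axis (ix n) 1) $ ix n = - lam"
      by (simp add: lam_def anti[of "axis (ix 0) 1"])
    ultimately have "C z (axis (ix n) 1) $ ix n = - lam * z $ ix 0"
      by (simp add: linear_diff[OF lin1] linear_scale[OF lin1] eq_neg_iff_add_eq_0 mult.commute)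
    then show ?thesis by (simp add: r_def Ci power2_eq_square)
  qed
  note b = bogoslovsky_parameter[OF n ix pm]
  \<comment> \<open>The equation is \<open>P \<eta>(q, -) + dP(q) \<eta>(z, -) + dT(q) dz\<^sup>0 = P r\<close>. Assuming
    \<open>dP(q) = k z\<^sup>0 P\<close> with \<open>k\<close> constant, each component of the equation determines one
    component of \<open>q\<close>; consistency then fixes \<open>k\<close>.\<close>
  define m where "m = lam * (1 - b) / (1 + b)"
  define k where "k = - 2 * b * lam / (1 + b)"
  have b': "1 - b \<noteq> 0" "1 + b \<noteq> 0" using b by auto
  \<comment> \<open>The component at \<open>ix n\<close> of the equation gives q^0 = -(lam + k)
    (z^0)^2, hence m = lam + k. Recomputing dP(q) / P from the resulting \<open>q\<close> gives b (k
    - 2 m) z^0, which must equal k z^0. These two conditions determine \<open>m\<close> and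
    \<open>k\<close>; the third relation serves to express the \<open>T\<close> term through
    \<open>P\<close>.\<close>
  have mk: "m = lam + k" "b * (k - 2 * m) = k" "(1 - b) * k = - 2 * b * m"
    using b' by (simp_all add: m_def k_def field_simps)
  define q :: "real^'m \<Rightarrow> real^'m" where "q z = (\<chi> j.
      if j = ix 0 then - m * (z $ ix 0 * z $ ix 0)
      else if j = ix n then (k / 2) * bogoslovsky_Q n ix z - r z (axis (ix 0) 1) - k * (z $ ix 0 * z $ ix n)
      else r z (axis j 1) - k * (z $ ix 0 * z $ j))" for z
  have q_nth: "q z $ ix 0 = - m * (z $ ix 0)\<^sup>2"
    "q z $ ix n = (k / 2) * bogoslovsky_Q n ix z - r z (axis (ix 0) 1) - k * (z $ ix 0 * z $ ix n)"
    "i \<in> {1..<n} \<Longrightarrow> q z $ ix i = r z (axis (ix i) 1) - k * (z $ ix 0 * z $ ix i)" for z i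
    using dist by (simp_all add: q_def power2_eq_square)
  have "quadratic (bogoslovsky_Q n ix)"
    unfolding bogoslovsky_Q_def[abs_def] power2_eq_square mult.assoc
    by (intro quadratic_diff quadratic_sum quadratic_cmult quadratic_linear_mult linear_vec_nth)
  then have "quadratic (\<lambda>z. q z $ ix n)"
    unfolding q_nth by (intro quadratic_diff quadratic_cmult quadratic_linear_mult linear_vec_nth r_quad)
  moreover have "quadratic (\<lambda>z. q z $ ix 0)"
    unfolding q_nth power2_eq_square by (intro quadratic_cmult quadratic_linear_mult linear_vec_nth)
  moreover have "quadratic (\<lambda>z. q z $ ix i)" if "i \<in> {1..<n}" for i
    unfolding q_nth(3)[OF that]
    by (intro quadratic_diff quadratic_cmult quadratic_linear_mult linear_vec_nth r_quad)
  ultimately have "quadratic (\<lambda>z. q z $ j)" for j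
    by (metis numbering_cases[OF n ix])
  moreover have "(hessian (bogoslovsky_L n ix b) z *v q z) \<bullet> w
      = (\<Sum>a\<in>UNIV. partial a (bogoslovsky_L n ix b) z * C z w $ a)"
    if z: "z \<in> bogoslovsky_cone n ix" for z w
  proof -
    note pos = cone_pos[OF z]
    let ?P = "bogoslovsky_P n ix b z" and ?T = "bogoslovsky_T n ix b z"
      and ?Q = "bogoslovsky_Q n ix z" and ?H = "hessian (bogoslovsky_L n ix b) z"
    \<comment> \<open>This is r(z, z) = 0 expanded in the basis. It replaces the middle sum in
      \<eta>(z, q) by the two outer terms.\<close>
    have rz: "z $ ix 0 * r z (axis (ix 0) 1) + (\<Sum>i\<in>{1..<n}. z $ ix i * r z (axis (ix i) 1))
        + z $ ix n * (lam * (z $ ix 0)\<^sup>2) = 0"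
      using linear_vec_expansion[OF r_lin, of z z] by (simp add: r_self sumU rn)
    have \<eta>q: "bogoslovsky_eta n ix z (q z) = k * ?Q * z $ ix 0 / 2"
    proof -
      have "bogoslovsky_eta n ix z (q z) = (\<Sum>i\<in>{1..<n}. z $ ix i * r z (axis (ix i) 1))
          - k * z $ ix 0 * (\<Sum>i\<in>{1..<n}. (z $ ix i)\<^sup>2)
          - z $ ix 0 * q z $ ix n - z $ ix n * q z $ ix 0"
        by (simp add: bogoslovsky_eta_def q_nth(3) right_diff_distrib sum_subtractf sum_distrib_left
            power2_eq_square mult_ac)
      moreover have "(\<Sum>i\<in>{1..<n}. (z $ ix i)\<^sup>2) = 2 * z $ ix 0 * z $ ix n - ?Q"
        by (simp add: bogoslovsky_Q_def)
      ultimately have "bogoslovsky_eta n ix z (q z) = (- (z $ ix 0 * r z (axis (ix 0) 1)) - z $ ix n * (lam * (z $ ix 0)\<^sup>2))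
          - k * z $ ix 0 * (2 * z $ ix 0 * z $ ix n - ?Q)
          - z $ ix 0 * ((k / 2) * ?Q - r z (axis (ix 0) 1) - k * (z $ ix 0 * z $ ix n))
          - z $ ix n * (- m * (z $ ix 0)\<^sup>2)"
        using rz by (simp add: q_nth)
      also have "\<dots> = k * ?Q * z $ ix 0 / 2"
        unfolding mk(1) by (simp add: field_simps power2_eq_square)
      finally show ?thesis .
    qed
    \<comment> \<open>The logarithmic derivative of \<open>P\<close> along \<open>q z\<close>; its
      value confirms the assumption from which \<open>q\<close> was built. \<open>brT\<close> is the
      analogue for \<open>T\<close>, with constant \<open>m\<close>.\<close>
    have brP: "2 * b * q z $ ix 0 / z $ ix 0 + 2 * b * bogoslovsky_eta n ix z (q z) / ?Q = k * z $ ix 0"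
    proof -
      have "2 * b * q z $ ix 0 / z $ ix 0 + 2 * b * bogoslovsky_eta n ix z (q z) / ?Q = b * (k - 2 * m) * z $ ix 0"
        using pos by (simp add: \<eta>q q_nth field_simps power2_eq_square)
      then show ?thesis using mk(2) by simp
    qed
    have brT: "(2 * b - 1) * q z $ ix 0 / z $ ix 0 - 2 * (1 - b) * bogoslovsky_eta n ix z (q z) / ?Q = m * z $ ix 0"
    proof -
      have "(2 * b - 1) * q z $ ix 0 / z $ ix 0 - 2 * (1 - b) * bogoslovsky_eta n ix z (q z) / ?Q
          = - (2 * b - 1) * m * z $ ix 0 - ((1 - b) * k) * z $ ix 0"
        using pos by (simp add: \<eta>q q_nth field_simps power2_eq_square)
      then show ?thesis unfolding mk(3) by (simp add: algebra_simps)
    qed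
    \<comment> \<open>After this \<open>P\<close> is a common factor of the whole equation. The
      passage from \<open>T\<close> to \<open>P\<close> divides by 1 - b.\<close>
    have T: "?T * (m * z $ ix 0) = ?P * (k / 2 * ?Q)"
    proof -
      have "(1 - b) * (?T * (m * z $ ix 0)) = m * ((1 - b) * ?T * z $ ix 0)" by simp
      also have "\<dots> = ?P * (- 2 * b * m) * ?Q / 2"
        unfolding bogoslovsky_T_P[OF n ix z] by simp
      also have "\<dots> = (1 - b) * (?P * (k / 2 * ?Q))"
        unfolding mk(3)[symmetric] by simp
      finally show ?thesis using b' by simp
    qed
    have axn: "axis a (1::real) $ ix 0 = (if a = ix 0 then 1 else 0)" for a
      by (simp add: axis_def)
    have Hq: "(?H *v q z) $ a = ?P * r z (axis a 1)" for a
    proof -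
      have "(?H *v q z) $ a = ?P * (bogoslovsky_eta n ix (q z) (axis a 1)
          + k * z $ ix 0 * bogoslovsky_eta n ix z (axis a 1) + (k / 2 * ?Q) * axis a 1 $ ix 0)"
        unfolding bogoslovsky_hessian_mult[OF n ix pm z] brP brT T by (simp add: algebra_simps)
      also have "\<dots> = ?P * r z (axis a 1)"
        by (cases rule: numbering_cases[OF n ix, of a])
          (use dist in \<open>simp_all add: ax q_nth rn mk(1) axn algebra_simps power2_eq_square\<close>)
      finally show ?thesis .
    qed
    have "(?H *v q z) \<bullet> w = ?P * r z w"
      by (subst linear_vec_expansion[OF r_lin])
        (simp add: inner_vec_def Hq sum_distrib_left mult_ac)
    moreover have "(\<Sum>a\<in>UNIV. partial a (bogoslovsky_L n ix b) z * C z w $ a) = ?P * r z w"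
      using dist by (simp add: sumU C0 partial_bogoslovsky_L[OF cone_open[OF n ix pm] z] ax axn
          r_def right_diff_distrib sum_distrib_left mult_ac)
    ultimately show ?thesis by simp
  qed
  ultimately show ?thesis using that by blast
qed

section \<open>Charts, tangent vectors and coframes\<close>

lemma frechet_derivative_eq_sum_partial:
  assumes "f differentiable (at x)"
  shows "frechet_derivative f (at x) h = (\<Sum>i\<in>UNIV. h $ i *\<^sub>R partial i f x)"
  by (simp add: frechet_derivative_at[OF has_derivative_sum_partial[OF assms], symmetric])

lemma partial_commute_vec:
  fixes f :: "real^'m::finite \<Rightarrow> real^'k::finite"
  assumes S: "open S" "x \<in> S" and C: "Ck_on 2 S f"
  shows "partial i (partial j f) x = partial j (partial i f) x"
proof -
  have C': "Ck_on (Suc (Suc 0)) S f" using C by (simp add: numeral_2_eq_2)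
  have "partial i (partial j f) x $ k = partial i (partial j (\<lambda>z. f z $ k)) x" for i j k
  proof -
    have "partial i (partial j f) x $ k = partial i (\<lambda>z. partial j f z $ k) x"
      using C' S by (simp add: partial_vec_nth)
    also have "\<dots> = partial i (partial j (\<lambda>z. f z $ k)) x"
      by (rule partial_cong[OF S]) (use C' in \<open>simp add: partial_vec_nth\<close>)
    finally show ?thesis .
  qed
  then show ?thesis
    using partial_commute[OF S Ck_on_vec_nth[OF S(1) C]] by (simp add: vec_eq_iff)
qed

text \<open>Along the line through \<open>x\<close> in direction \<open>h\<close> the coordinates in
  \<open>J\<close> do not change, so \<open>f\<close> is constant on it as long as it stays in
  \<open>S\<close>, in particular near \<open>x\<close>; uniqueness of derivatives finishes the
  argument.\<close>

lemma frechet_derivative_depends_only_on: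
  fixes f :: "real^'m::finite \<Rightarrow> real"
  assumes S: "open S" "x \<in> S" and dep: "depends_only_on J S f" and f: "f differentiable (at x)"
    and h: "\<And>j. j \<in> J \<Longrightarrow> h $ j = 0"
  shows "frechet_derivative f (at x) h = 0"
proof -
  have line: "((\<lambda>t. x + t *\<^sub>R h) has_derivative (\<lambda>t. t *\<^sub>R h)) (at 0)"
    by (auto intro!: derivative_eq_intros)
  have f': "(f has_derivative frechet_derivative f (at x)) (at (x + 0 *\<^sub>R h))"
    using f[unfolded frechet_derivative_works] by simp
  have 1: "((\<lambda>t. f (x + t *\<^sub>R h)) has_derivative (\<lambda>t. frechet_derivative f (at x) (t *\<^sub>R h))) (at 0)"
    using diff_chain_at[OF line f'] by (simp add: o_def)
  have op: "open ((\<lambda>t. x + t *\<^sub>R h) -` S)"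
    using S(1) by (intro open_vimage continuous_intros)
  have "((\<lambda>t. f x) has_derivative (\<lambda>t. frechet_derivative f (at x) (t *\<^sub>R h))) (at 0)"
  proof (rule has_derivative_transform_within_open[OF 1 op])
    show "0 \<in> (\<lambda>t. x + t *\<^sub>R h) -` S" using S by simp
    fix t assume "t \<in> (\<lambda>t. x + t *\<^sub>R h) -` S"
    moreover have "\<forall>j\<in>J. (x + t *\<^sub>R h) $ j = x $ j" using h by simp
    ultimately show "f (x + t *\<^sub>R h) = f x" using dep S(2) unfolding depends_only_on_def by blast
  qed
  from fun_cong[OF has_derivative_unique[OF this has_derivative_const], of 1] show ?thesis by simp
qed

context
  fixes A :: "('p::{t2_space,second_countable_topology}, 'm::finite) chart set"
  assumes A: "smooth_atlas A"
begin

lemma chart_point_inverse: "c \<in> A \<Longrightarrow> p \<in> fst c \<Longrightarrow> chart_point c (snd c p) = p"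
  using A unfolding smooth_atlas_def homeomorphism_def by blast

lemma chart_overlap_open:
  assumes "c \<in> A" "c' \<in> A"
  shows "open (snd c ` (fst c \<inter> fst c'))"
proof -
  have "snd c ` (fst c \<inter> fst c') = snd c ` fst c \<inter> chart_point c -` fst c'"
    using chart_point_inverse[OF assms(1)] by force
  moreover have "open (snd c ` fst c \<inter> chart_point c -` fst c')"
    by (rule continuous_open_preimage) (use A assms in \<open>simp_all add: smooth_atlas_def homeomorphism_def\<close>)
  ultimately show ?thesis by simp
qed

lemma chart_image_open: "c \<in> A \<Longrightarrow> open (snd c ` fst c)"
  using chart_overlap_open[of c c] by simp

lemma transition_apply:
  "c \<in> A \<Longrightarrow> p \<in> fst c \<Longrightarrow> transition c c' (snd c p) = snd c' p"
  by (simp add: transition_def chart_point_inverse)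

lemma transition_smooth:
  assumes "c \<in> A" "c' \<in> A"
  shows "Ck_on k (snd c ` (fst c \<inter> fst c')) (transition c c')"
  using A assms by (simp add: smooth_atlas_def smooth_on_def)

lemma transition_differentiable:
  assumes "c \<in> A" "c' \<in> A" "p \<in> fst c" "p \<in> fst c'"
  shows "transition c c' differentiable (at (snd c p))"
proof -
  have "snd c p \<in> snd c ` (fst c \<inter> fst c')" using assms(3,4) by blast
  then show ?thesis using transition_smooth[OF assms(1,2), of "Suc 0"] unfolding Ck_on.simps by blast
qed

lemma tangent_space_component:
  assumes "w \<in> tangent_space A p" "c \<in> A" "c' \<in> A" "p \<in> fst c" "p \<in> fst c'"
  shows "w c' = frechet_derivative (transition c c') (at (snd c p)) (w c)"
  using assms unfolding tangent_space_def by blast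

lemma tangent_space_eqI:
  assumes "w \<in> tangent_space A p" "w' \<in> tangent_space A p" "c \<in> A" "p \<in> fst c" "w c = w' c"
  shows "w = w'"
proof
  fix c'
  show "w c' = w' c'"
  proof (cases "c' \<in> A \<and> p \<in> fst c'")
    case True
    then have "w c' = frechet_derivative (transition c c') (at (snd c p)) (w c)"
      "w' c' = frechet_derivative (transition c c') (at (snd c p)) (w' c)"
      using tangent_space_component[OF assms(1,3)] tangent_space_component[OF assms(2,3)] assms(4) by blast+
    then show ?thesis using assms(5) by (simp only:)
  next
    case False
    then have "w c' = 0" "w' c' = 0" using assms(1,2) unfolding tangent_space_def by blast+
    then show ?thesis by simp
  qed
qed

lemma tvec_of_eqI:
  assumes "w \<in> tangent_space A p" "c \<in> A" "p \<in> fst c" "w c = y"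
  shows "tvec_of A c p y = w"
  unfolding tvec_of_def
proof (rule the_equality)
  show "w \<in> tangent_space A p \<and> w c = y" using assms by simp
  show "w' = w" if "w' \<in> tangent_space A p \<and> w' c = y" for w'
    by (rule tangent_space_eqI[of w' p w c]) (use assms that in simp_all)
qed

end

section \<open>The coframe of the local form and its derivative\<close>

lemma has_derivative_linear_family:
  fixes E :: "'a::real_normed_vector \<Rightarrow> real^'m::finite \<Rightarrow> 'b::real_normed_vector"
  assumes S: "open S" "x0 \<in> S" and lin: "\<And>x. x \<in> S \<Longrightarrow> linear (E x)" "\<And>h. linear (E' h)"
    and E: "\<And>v. ((\<lambda>x. E x v) has_derivative (\<lambda>h. E' h v)) (at x0)"
    and u: "(u has_derivative u') (at x0)"
  shows "((\<lambda>x. E x (u x)) has_derivative (\<lambda>h. E' h (u x0) + E x0 (u' h))) (at x0)"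
proof -
  \<comment> \<open>Expanding in the basis reduces the claim to the product rule for finitely many
    scalar factors.\<close>
  have "((\<lambda>x. \<Sum>k\<in>UNIV. u x $ k *\<^sub>R E x (axis k 1)) has_derivative
      (\<lambda>h. \<Sum>k\<in>UNIV. u x0 $ k *\<^sub>R E' h (axis k 1) + u' h $ k *\<^sub>R E x0 (axis k 1))) (at x0)"
    by (intro has_derivative_sum has_derivative_scaleR has_derivative_vec_nth E u)
  then have "((\<lambda>x. \<Sum>k\<in>UNIV. u x $ k *\<^sub>R E x (axis k 1)) has_derivative
      (\<lambda>h. E' h (u x0) + E x0 (u' h))) (at x0)"
    by (rule has_derivative_eq_rhs)
      (simp add: fun_eq_iff sum.distrib flip: linear_vec_expansion[OF lin(2)]
        linear_vec_expansion[OF lin(1)[OF S(2)]])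
  then show ?thesis
    by (rule has_derivative_transform_within_open[OF _ S])
      (simp flip: linear_vec_expansion[OF lin(1)])
qed

text \<open>The last three claims are the conditions on the exterior derivative, stated without
  inverting \<open>E x\<close>: the hypothesis on \<open>w\<close> makes it a multiple of the frame
  vector number \<open>n\<close>, which is the coordinate vector of v. They hold because dU is a
  multiple of du, all coefficients except \<open>V\<close> are constant along v, and
  \<open>V\<close> occurs only in front of du.\<close>

lemma vierbein_coframe:
  fixes n :: nat and ix :: "nat \<Rightarrow> 'm::finite"
    and c :: "('p::{t2_space,second_countable_topology}, 'm) chart"
  assumes n: "1 \<le> n" and ix: "bij_betw ix {0..n} (UNIV :: 'm set)"
    and form: "vierbein_local_form n ix A c e" and op: "open (snd c ` fst c)"
  obtains E :: "real^'m \<Rightarrow> real^'m \<Rightarrow> real^'m" and E' :: "real^'m \<Rightarrow> real^'m \<Rightarrow> real^'m \<Rightarrow> real^'m" where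
    "\<And>p w. p \<in> fst c \<Longrightarrow> w \<in> tangent_space A p \<Longrightarrow> (\<chi> k. e k p w) = E (snd c p) (w c)"
    "\<And>x. linear (E x)" "\<And>x h. linear (E' x h)"
    "\<And>x w. x \<in> snd c ` fst c \<Longrightarrow> ((\<lambda>x. E x w) has_derivative (\<lambda>h. E' x h w)) (at x)"
    "\<And>x y w. x \<in> snd c ` fst c \<Longrightarrow> E' x y w $ ix 0 = E' x w y $ ix 0"
    "\<And>x y w i. x \<in> snd c ` fst c \<Longrightarrow> (\<And>k. k \<noteq> ix n \<Longrightarrow> E x w $ k = 0) \<Longrightarrow> i \<in> {1..<n}
       \<Longrightarrow> E' x y w $ ix i = E' x w y $ ix i"
    "\<And>x y w. x \<in> snd c ` fst c \<Longrightarrow> (\<And>k. k \<noteq> ix n \<Longrightarrow> E x w $ k = 0) \<Longrightarrow> E x y $ ix 0 = 0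
       \<Longrightarrow> E' x y w $ ix n = E' x w y $ ix n"
proof -
  let ?S = "snd c ` fst c" and ?I = "{1..<n}"
  note dist = numbering_distinct[OF n ix]
  obtain U :: "real^'m \<Rightarrow> real" and Zm :: "nat \<Rightarrow> nat \<Rightarrow> real^'m \<Rightarrow> real" and Z :: "nat \<Rightarrow> real^'m \<Rightarrow> real"
    and V :: "real^'m \<Rightarrow> real" and Vv :: "nat \<Rightarrow> real^'m \<Rightarrow> real"
    where F: "Ck_on 1 ?S U \<and> depends_only_on {ix 0} ?S U \<and> (\<forall>x\<in>?S. U x \<noteq> 0) \<and>
        (\<forall>i\<in>?I. \<forall>j\<in>?I. Ck_on 1 ?S (Zm i j) \<and> depends_only_on (ix ` {0..<n}) ?S (Zm i j)) \<and>
        (\<forall>x\<in>?S. invertible_on ?I (\<lambda>i j. Zm i j x)) \<and>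
        (\<forall>i\<in>?I. Ck_on 1 ?S (Z i) \<and> depends_only_on (ix ` {0..<n}) ?S (Z i)) \<and>
        Ck_on 1 ?S V \<and>
        (\<forall>j\<in>?I. Ck_on 1 ?S (Vv j) \<and> depends_only_on (ix ` {0..<n}) ?S (Vv j)) \<and>
        (\<forall>p\<in>fst c. \<forall>w\<in>tangent_space A p.
           e (ix 0) p w = U (snd c p) * w c $ ix 0 \<and>
           (\<forall>i\<in>?I. e (ix i) p w
              = (\<Sum>j\<in>?I. Zm i j (snd c p) * w c $ ix j) + Z i (snd c p) * w c $ ix 0) \<and>
           e (ix n) p w
              = w c $ ix n + V (snd c p) * w c $ ix 0 + (\<Sum>j\<in>?I. Vv j (snd c p) * w c $ ix j))"
    using form unfolding vierbein_local_form_def Let_def by (elim exE) (rule that)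
  from F have U: "Ck_on 1 ?S U" "depends_only_on {ix 0} ?S U" "\<And>x. x \<in> ?S \<Longrightarrow> U x \<noteq> 0"
    by blast+
  from F have Zm: "\<And>i j. i \<in> ?I \<Longrightarrow> j \<in> ?I \<Longrightarrow> Ck_on 1 ?S (Zm i j)"
      "\<And>i j. i \<in> ?I \<Longrightarrow> j \<in> ?I \<Longrightarrow> depends_only_on (ix ` {0..<n}) ?S (Zm i j)"
      "\<And>x. x \<in> ?S \<Longrightarrow> invertible_on ?I (\<lambda>i j. Zm i j x)"
    by blast+
  from F have Z: "\<And>i. i \<in> ?I \<Longrightarrow> Ck_on 1 ?S (Z i)"
      "\<And>i. i \<in> ?I \<Longrightarrow> depends_only_on (ix ` {0..<n}) ?S (Z i)"
    by blast+
  from F have Vv: "Ck_on 1 ?S V" "\<And>i. i \<in> ?I \<Longrightarrow> Ck_on 1 ?S (Vv i)"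
      "\<And>i. i \<in> ?I \<Longrightarrow> depends_only_on (ix ` {0..<n}) ?S (Vv i)"
    by blast+
  from F have e: "\<And>p w. p \<in> fst c \<Longrightarrow> w \<in> tangent_space A p \<Longrightarrow> e (ix 0) p w = U (snd c p) * w c $ ix 0"
      "\<And>p w i. p \<in> fst c \<Longrightarrow> w \<in> tangent_space A p \<Longrightarrow> i \<in> ?I \<Longrightarrow> e (ix i) p w
              = (\<Sum>j\<in>?I. Zm i j (snd c p) * w c $ ix j) + Z i (snd c p) * w c $ ix 0"
      "\<And>p w. p \<in> fst c \<Longrightarrow> w \<in> tangent_space A p \<Longrightarrow> e (ix n) p w
              = w c $ ix n + V (snd c p) * w c $ ix 0 + (\<Sum>j\<in>?I. Vv j (snd c p) * w c $ ix j)"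
    by blast+
  \<comment> \<open>Components are indexed by the type \<open>'m\<close>, the coefficients by
    numbers; \<open>num\<close> translates back.\<close>
  define num where "num = inv_into {0..n} ix"
  have num: "num (ix i) = i" if "i \<le> n" for i
    using ix that by (simp add: num_def bij_betw_def)
  define E :: "real^'m \<Rightarrow> real^'m \<Rightarrow> real^'m" where "E x w = (\<chi> k.
      if k = ix 0 then U x * w $ ix 0
      else if k = ix n then w $ ix n + V x * w $ ix 0 + (\<Sum>j\<in>?I. Vv j x * w $ ix j)
      else (\<Sum>j\<in>?I. Zm (num k) j x * w $ ix j) + Z (num k) x * w $ ix 0)" for x w
  define D where "D f x h = frechet_derivative f (at x) h" for f :: "real^'m \<Rightarrow> real" and x h
  define E' :: "real^'m \<Rightarrow> real^'m \<Rightarrow> real^'m \<Rightarrow> real^'m" where "E' x h w = (\<chi> k.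
      if k = ix 0 then D U x h * w $ ix 0
      else if k = ix n then D V x h * w $ ix 0 + (\<Sum>j\<in>?I. D (Vv j) x h * w $ ix j)
      else (\<Sum>j\<in>?I. D (Zm (num k) j) x h * w $ ix j) + D (Z (num k)) x h * w $ ix 0)" for x h w
  have E_nth: "E x w $ ix 0 = U x * w $ ix 0"
    "E x w $ ix n = w $ ix n + V x * w $ ix 0 + (\<Sum>j\<in>?I. Vv j x * w $ ix j)"
    "i \<in> ?I \<Longrightarrow> E x w $ ix i = (\<Sum>j\<in>?I. Zm i j x * w $ ix j) + Z i x * w $ ix 0" for x w i
    using dist by (simp_all add: E_def num)
  have E'_nth: "E' x h w $ ix 0 = D U x h * w $ ix 0"
    "E' x h w $ ix n = D V x h * w $ ix 0 + (\<Sum>j\<in>?I. D (Vv j) x h * w $ ix j)"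
    "i \<in> ?I \<Longrightarrow> E' x h w $ ix i = (\<Sum>j\<in>?I. D (Zm i j) x h * w $ ix j) + D (Z i) x h * w $ ix 0" for x h w i
    using dist by (simp_all add: E'_def num)
  have vec_eqI: "u = v" if "u $ ix 0 = v $ ix 0" "u $ ix n = v $ ix n"
    "\<And>i. i \<in> ?I \<Longrightarrow> u $ ix i = v $ ix i" for u v :: "real^'m"
    unfolding vec_eq_iff using that numbering_cases[OF n ix] by metis
  have DD: "(f has_derivative D f x) (at x)" if "Ck_on 1 ?S f" "x \<in> ?S" for f x
    using that frechet_derivative_works unfolding D_def[abs_def] by auto
  have D0: "D f x h = 0" if "Ck_on 1 ?S f" "x \<in> ?S" "depends_only_on J ?S f" "\<And>j. j \<in> J \<Longrightarrow> h $ j = 0"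
    for f x J h
    unfolding D_def by (rule frechet_derivative_depends_only_on[OF op]) (use that in auto)
  \<comment> \<open>The coframe is block triangular: \<open>U\<close> being nonzero removes the
    component along u, then invertibility of \<open>Zm\<close> removes the middle ones.\<close>
  have w0: "w $ k = 0" if x: "x \<in> ?S" and w: "\<And>k. k \<noteq> ix n \<Longrightarrow> E x w $ k = 0" and k: "k \<noteq> ix n" for x w k
  proof -
    have 0: "w $ ix 0 = 0" using w[of "ix 0"] dist U(3)[OF x] by (simp add: E_nth)
    have Zw: "(\<Sum>j\<in>?I. Zm i j x * w $ ix j) = 0" if "i \<in> ?I" for i
      using w[of "ix i"] dist that by (simp add: E_nth 0)
    obtain W where W: "\<And>i k. i \<in> ?I \<Longrightarrow> k \<in> ?I \<Longrightarrow> (\<Sum>j\<in>?I. W i j * Zm j k x) = (if i = k then 1 else 0)"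
      using Zm(3)[OF x] unfolding invertible_on_def by blast
    have "w $ ix i = 0" if i: "i \<in> ?I" for i
    proof -
      have "w $ ix i = (\<Sum>k\<in>?I. if k = i then w $ ix k else 0)" using i by simp
      also have "\<dots> = (\<Sum>k\<in>?I. (\<Sum>j\<in>?I. W i j * Zm j k x) * w $ ix k)"
      proof (rule sum.cong[OF refl])
        fix k assume "k \<in> ?I"
        from W[OF i this] show "(if k = i then w $ ix k else 0) = (\<Sum>j\<in>?I. W i j * Zm j k x) * w $ ix k"
          by (cases "k = i") simp_all
      qed
      also have "\<dots> = (\<Sum>k\<in>?I. \<Sum>j\<in>?I. W i j * (Zm j k x * w $ ix k))"
        by (simp add: sum_distrib_right mult.assoc)
      also have "\<dots> = (\<Sum>j\<in>?I. \<Sum>k\<in>?I. W i j * (Zm j k x * w $ ix k))"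
        by (rule sum.swap)
      also have "\<dots> = (\<Sum>j\<in>?I. W i j * (\<Sum>k\<in>?I. Zm j k x * w $ ix k))"
        by (simp add: sum_distrib_left)
      also have "\<dots> = 0" by (rule sum.neutral) (use Zw in simp)
      finally show ?thesis .
    qed
    with 0 k show ?thesis by (cases rule: numbering_cases[OF n ix, of k]) auto
  qed
  have wJ: "w $ j = 0" if x: "x \<in> ?S" and w: "\<And>k. k \<noteq> ix n \<Longrightarrow> E x w $ k = 0" and j: "j \<in> ix ` {0..<n}" for x w j
  proof -
    obtain i where "j = ix i" "i < n" using j by auto
    then show ?thesis using w0[OF x w] numbering_eq_iff[OF ix, of i n] by simp
  qed
  show ?thesis
  proof
    show "(\<chi> k. e k p w) = E (snd c p) (w c)" if "p \<in> fst c" "w \<in> tangent_space A p" for p w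
      using that by (intro vec_eqI) (simp_all add: e E_nth)
    show "linear (E x)" for x
    proof (rule linearI)
      show "E x (u + w) = E x u + E x w" for u w
        by (rule vec_eqI) (simp_all only: E_nth vector_add_component distrib_left sum.distrib add_ac)
      show "E x (r *\<^sub>R u) = r *\<^sub>R E x u" for r u
        by (rule vec_eqI)
          (simp_all only: E_nth vector_scaleR_component real_scaleR_def distrib_left sum_distrib_left mult.left_commute)
    qed
    show "linear (E' x h)" for x h
    proof (rule linearI)
      show "E' x h (u + w) = E' x h u + E' x h w" for u w
        by (rule vec_eqI) (simp_all only: E'_nth vector_add_component distrib_left sum.distrib add_ac)
      show "E' x h (r *\<^sub>R u) = r *\<^sub>R E' x h u" for r u
        by (rule vec_eqI)
          (simp_all only: E'_nth vector_scaleR_component real_scaleR_def distrib_left sum_distrib_left mult.left_commute)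
    qed
    show "((\<lambda>x. E x w) has_derivative (\<lambda>h. E' x h w)) (at x)" if x: "x \<in> ?S" for x w
      unfolding E_def E'_def
    proof (rule has_derivative_vec_lambda)
      fix k
      consider "k = ix 0" | "k = ix n" | i where "k = ix i" "i \<in> ?I" by (rule numbering_cases[OF n ix])
      then show "((\<lambda>x. if k = ix 0 then U x * w $ ix 0
          else if k = ix n then w $ ix n + V x * w $ ix 0 + (\<Sum>j\<in>?I. Vv j x * w $ ix j)
          else (\<Sum>j\<in>?I. Zm (num k) j x * w $ ix j) + Z (num k) x * w $ ix 0) has_derivative
        (\<lambda>h. if k = ix 0 then D U x h * w $ ix 0
          else if k = ix n then D V x h * w $ ix 0 + (\<Sum>j\<in>?I. D (Vv j) x h * w $ ix j)
          else (\<Sum>j\<in>?I. D (Zm (num k) j) x h * w $ ix j) + D (Z (num k)) x h * w $ ix 0)) (at x)"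
      proof cases
        case 1
        then show ?thesis using DD[OF U(1) x] by (simp add: has_derivative_mult_left)
      next
        case 2
        have "((\<lambda>x. w $ ix n + V x * w $ ix 0 + (\<Sum>j\<in>?I. Vv j x * w $ ix j)) has_derivative
            (\<lambda>h. 0 + D V x h * w $ ix 0 + (\<Sum>j\<in>?I. D (Vv j) x h * w $ ix j))) (at x)"
          by (intro has_derivative_add has_derivative_const has_derivative_sum has_derivative_mult_left DD Vv x)
        then show ?thesis using 2 dist by simp
      next
        case (3 i)
        have "((\<lambda>x. (\<Sum>j\<in>?I. Zm i j x * w $ ix j) + Z i x * w $ ix 0) has_derivative
            (\<lambda>h. (\<Sum>j\<in>?I. D (Zm i j) x h * w $ ix j) + D (Z i) x h * w $ ix 0)) (at x)"
          by (intro has_derivative_add has_derivative_sum has_derivative_mult_left DD Zm Z x 3)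
        then show ?thesis using 3 dist by (simp add: num)
      qed
    qed
    show "E' x y w $ ix 0 = E' x w y $ ix 0" if x: "x \<in> ?S" for x y w
    proof -
      have lin: "linear (D U x)" using DD[OF U(1) x] by (rule has_derivative_linear)
      have *: "D U x h = h $ ix 0 * D U x (axis (ix 0) 1)" for h
        using D0[OF U(1) x U(2), of "h - h $ ix 0 *\<^sub>R axis (ix 0) 1"]
        by (simp add: linear_diff[OF lin] linear_scale[OF lin])
      show ?thesis using *[of y] *[of w] by (simp add: E'_nth)
    qed
    show "E' x y w $ ix i = E' x w y $ ix i"
      if x: "x \<in> ?S" and w: "\<And>k. k \<noteq> ix n \<Longrightarrow> E x w $ k = 0" and i: "i \<in> ?I" for x y w i
    proof -
      have "D (Zm i j) x w = 0" if "j \<in> ?I" for j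
        by (rule D0[OF Zm(1)[OF i that] x Zm(2)[OF i that] wJ[OF x w]])
      moreover have "D (Z i) x w = 0"
        by (rule D0[OF Z(1)[OF i] x Z(2)[OF i] wJ[OF x w]])
      ultimately have "E' x w y $ ix i = 0" using E'_nth(3)[OF i] by simp
      moreover have "E' x y w $ ix i = 0" using E'_nth(3)[OF i] w0[OF x w] dist by simp
      ultimately show ?thesis by simp
    qed
    show "E' x y w $ ix n = E' x w y $ ix n"
      if x: "x \<in> ?S" and w: "\<And>k. k \<noteq> ix n \<Longrightarrow> E x w $ k = 0" and y: "E x y $ ix 0 = 0" for x y w
    proof -
      \<comment> \<open>The only derivative along v that can survive is that of \<open>V\<close>,
        and it is multiplied by this component.\<close>
      have "y $ ix 0 = 0" using y U(3)[OF x] by (simp add: E_nth)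
      moreover have "D (Vv j) x w = 0" if "j \<in> ?I" for j
        by (rule D0[OF Vv(2)[OF that] x Vv(3)[OF that] wJ[OF x w]])
      ultimately have "E' x w y $ ix n = 0" by (simp add: E'_nth(2))
      moreover have "E' x y w $ ix n = 0" using w0[OF x w] dist by (simp add: E'_nth(2))
      ultimately show ?thesis by simp
    qed
  qed
qed

section \<open>From the coframe to the Lagrangian in a chart\<close>

lemma vierbein_isomorphism:
  fixes e :: "'m::finite \<Rightarrow> 'p \<Rightarrow> ('p::{t2_space,second_countable_topology}, 'm) tvec \<Rightarrow> real"
  assumes A: "smooth_atlas A" and c: "c \<in> A" "p \<in> fst c"
    and md: "modeled_with_vierbein A \<Omega> \<L> \<omega> L D e" and p: "p \<in> D"
    and F: "linear F" "\<And>w. w \<in> tangent_space A p \<Longrightarrow> (\<chi> k. e k p w) = F (w c)"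
  obtains B :: "real^'m^'m" where "\<And>w. B *v F w = w" "\<And>w. F (B *v w) = w"
proof -
  have indep: "\<forall>k. a k = 0" if "\<And>w. w \<in> tangent_space A p \<Longrightarrow> (\<Sum>k\<in>UNIV. a k * e k p w) = 0" for a
    using md p that unfolding modeled_with_vierbein_def by blast
  have F_matrix: "matrix F *v w = F w" for w using F(1) by (simp add: matrix_works linear_matrix_vector_mul_eq)
  \<comment> \<open>A relation between the rows of the matrix of \<open>F\<close> is a relation
    between the 1-forms on all tangent vectors, so independence passes from the forms to the
    rows.\<close>
  have "\<forall>a. (\<Sum>k\<in>UNIV. a k *s row k (matrix F)) = 0 \<longrightarrow> (\<forall>k. a k = 0)"
  proof (intro allI impI)
    fix a k assume a: "(\<Sum>k\<in>UNIV. a k *s row k (matrix F)) = 0"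
    have "(\<Sum>k\<in>UNIV. a k * e k p w) = 0" if w: "w \<in> tangent_space A p" for w
    proof -
      have "e k p w = row k (matrix F) \<bullet> w c" for k
      proof -
        have "e k p w = (matrix F *v w c) $ k" using arg_cong[OF F(2)[OF w], of "\<lambda>v. v $ k"] by (simp add: F_matrix)
        then show ?thesis by (simp add: matrix_vector_mult_def row_def inner_vec_def)
      qed
      then have "(\<Sum>k\<in>UNIV. a k * e k p w) = (\<Sum>k\<in>UNIV. a k *s row k (matrix F)) \<bullet> w c"
        by (simp add: inner_sum_left scalar_mult_eq_scaleR)
      then show ?thesis by (simp add: a)
    qed
    from indep[OF this] show "a k = 0" by simp
  qed
  then obtain B where B: "matrix F ** B = mat 1"
    using matrix_right_invertible_independent_rows by blast
  then have "B ** matrix F = mat 1" using matrix_left_right_inverse by blast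
  then have "B *v F w = w" for w by (metis F_matrix matrix_vector_mul_assoc matrix_vector_mul_lid)
  moreover have "F (B *v w) = w" for w
    using B by (metis F_matrix matrix_vector_mul_assoc matrix_vector_mul_lid)
  ultimately show ?thesis using that by blast
qed

text \<open>The tangent vector with components \<open>y\<close> is found in the fibre: the coframe
  maps the fibre onto \<open>\<omega>\<close>, which contains \<open>F y\<close>, and injectivity of
  \<open>F\<close> shows that the preimage has components \<open>y\<close>. It also lies in the
  fibre closure, where \<L> is prescribed.\<close>

lemma local_lagrangian_modeled:
  fixes e :: "'m::finite \<Rightarrow> 'p \<Rightarrow> ('p::{t2_space,second_countable_topology}, 'm) tvec \<Rightarrow> real"
  assumes A: "smooth_atlas A" and c: "c \<in> A" "p \<in> fst c"
    and \<Omega>: "\<Omega> \<subseteq> tangent_bundle A"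
    and md: "modeled_with_vierbein A \<Omega> \<L> \<omega> L D e" and p: "p \<in> D"
    and F: "linear F" "\<And>w. w \<in> tangent_space A p \<Longrightarrow> (\<chi> k. e k p w) = F (w c)"
    and y: "F y \<in> \<omega>"
  shows "local_lagrangian A \<L> c (snd c p) y = L (F y)"
proof -
  obtain B where B: "\<And>w. B *v F w = w" "\<And>w. F (B *v w) = w"
    using vierbein_isomorphism[OF A c md p F] by blast
  have im: "(\<lambda>w. \<chi> k. e k p w) ` fibre \<Omega> p = \<omega>"
    and L: "\<And>w. w \<in> fibre_closure A \<Omega> p \<Longrightarrow> \<L> p w = L (\<chi> k. e k p w)"
    using md p unfolding modeled_with_vierbein_def by blast+
  have "F y \<in> (\<lambda>w. \<chi> k. e k p w) ` fibre \<Omega> p" unfolding im by (rule y)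
  then obtain w where w: "w \<in> fibre \<Omega> p" "F y = (\<chi> k. e k p w)" by (rule imageE)
  have wT: "w \<in> tangent_space A p" using w(1) \<Omega> by (auto simp: fibre_def tangent_bundle_def)
  have "w c = B *v F (w c)" by (rule B(1)[symmetric])
  also have "\<dots> = y" unfolding F(2)[OF wT, symmetric] w(2)[symmetric] by (rule B(1))
  finally have "w c = y" .
  then have "tvec_of A c p y = w" using tvec_of_eqI[OF A wT c] by simp
  moreover have "w \<in> fibre_closure A \<Omega> p"
    unfolding fibre_closure_def
  proof (intro CollectI conjI ballI impI wT)
    fix c'
    have "w c' \<in> fibre_in_chart \<Omega> c' p" using w(1) unfolding fibre_in_chart_def by (rule imageI)
    then show "w c' \<in> closure (fibre_in_chart \<Omega> c' p)" using closure_subset by blast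
  qed
  ultimately show ?thesis
    using L w(2) by (simp add: local_lagrangian_def chart_point_inverse[OF A c])
qed

lemma linear_sum_scaleR:
  fixes v :: "'m::finite \<Rightarrow> 'b::real_vector"
  shows "linear (\<lambda>w :: real^'m. \<Sum>i\<in>UNIV. w $ i *\<^sub>R v i)"
  by (rule linearI) (simp_all add: scaleR_left_distrib sum.distrib scaleR_sum_right)

lemma quadratic_bilinear_self:
  fixes f :: "real^'m::finite \<Rightarrow> real^'m \<Rightarrow> real"
  assumes "\<And>w. linear (\<lambda>y. f y w)" "\<And>y. linear (f y)"
  shows "quadratic (\<lambda>y. f y y)"
proof -
  have eq: "(\<lambda>y. f y y) = (\<lambda>y. \<Sum>i\<in>UNIV. y $ i * f y (axis i 1))"
  proof
    fix y
    show "f y y = (\<Sum>i\<in>UNIV. y $ i * f y (axis i 1))"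
      using linear_vec_expansion[OF assms(2), of y y] by (simp only: real_scaleR_def)
  qed
  show ?thesis
    by (subst eq) (intro quadratic_sum quadratic_linear_mult linear_vec_nth assms)
qed

section \<open>The Berwald property\<close>

theorem theorem2:
  fixes n :: nat and b :: real and ix :: "nat \<Rightarrow> 'm::finite"
    and A :: "('p::{t2_space,second_countable_topology}, 'm) chart set"
    and \<Omega> :: "('p \<times> ('p, 'm) tvec) set"
    and \<L> :: "'p \<Rightarrow> ('p, 'm) tvec \<Rightarrow> real"
  assumes "n \<ge> 1"
    and "bij_betw ix {0..n} (UNIV :: 'm set)"
    and "lorentz_minkowski (bogoslovsky_cone n ix) (bogoslovsky_L n ix b)"
    and "smooth_atlas A"
    and "lorentz_finsler A \<Omega> \<L>"
    and "\<And>p. \<exists>c\<in>A. p \<in> fst c \<and>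
           (\<exists>e. modeled_with_vierbein A \<Omega> \<L> (bogoslovsky_cone n ix) (bogoslovsky_L n ix b) (fst c) e \<and>
                vierbein_local_form n ix A c e)"
  shows "berwald A \<Omega> \<L>"
  unfolding berwald_def
proof (intro ballI)
  fix c p assume c: "c \<in> A" and p: "p \<in> fst c"
  note n = assms(1) and ix = assms(2) and A = assms(4)
  let ?\<omega> = "bogoslovsky_cone n ix" and ?L = "bogoslovsky_L n ix b"
  have pm: "pseudo_minkowski ?\<omega> ?L" using assms(3) by (simp add: lorentz_minkowski_def)
  have \<Omega>: "\<Omega> \<subseteq> tangent_bundle A" using assms(5) by (simp add: lorentz_finsler_def)
  obtain c0 e where c0: "c0 \<in> A" "p \<in> fst c0"
    and md: "modeled_with_vierbein A \<Omega> \<L> ?\<omega> ?L (fst c0) e" and form: "vierbein_local_form n ix A c0 e"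
    using assms(6) by blast
  obtain E :: "real^'m \<Rightarrow> real^'m \<Rightarrow> real^'m" and E' :: "real^'m \<Rightarrow> real^'m \<Rightarrow> real^'m \<Rightarrow> real^'m" where
    E: "\<And>p w. p \<in> fst c0 \<Longrightarrow> w \<in> tangent_space A p \<Longrightarrow> (\<chi> k. e k p w) = E (snd c0 p) (w c0)"
    and E_lin: "\<And>x. linear (E x)" and E'_lin: "\<And>x h. linear (E' x h)"
    and E_der: "\<And>x w. x \<in> snd c0 ` fst c0 \<Longrightarrow> ((\<lambda>x. E x w) has_derivative (\<lambda>h. E' x h w)) (at x)"
    and E0: "\<And>x y w. x \<in> snd c0 ` fst c0 \<Longrightarrow> E' x y w $ ix 0 = E' x w y $ ix 0"
    and Ei: "\<And>x y w i. x \<in> snd c0 ` fst c0 \<Longrightarrow> (\<And>k. k \<noteq> ix n \<Longrightarrow> E x w $ k = 0) \<Longrightarrow> i \<in> {1..<n}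
       \<Longrightarrow> E' x y w $ ix i = E' x w y $ ix i"
    and En: "\<And>x y w. x \<in> snd c0 ` fst c0 \<Longrightarrow> (\<And>k. k \<noteq> ix n \<Longrightarrow> E x w $ k = 0) \<Longrightarrow> E x y $ ix 0 = 0
       \<Longrightarrow> E' x y w $ ix n = E' x w y $ ix n"
    using vierbein_coframe[OF n ix form chart_image_open[OF A c0(1)]] by blast
  define \<tau> where "\<tau> = transition c c0"
  define S where "S = snd c ` (fst c \<inter> fst c0)"
  define x0 where "x0 = snd c p"
  have S: "open S" "x0 \<in> S" using chart_overlap_open[OF A c c0(1)] p c0 by (auto simp: S_def x0_def)
  have \<tau>x0: "\<tau> x0 = snd c0 p" using transition_apply[OF A c p] by (simp add: \<tau>_def x0_def)
  have \<tau>x0_in: "\<tau> x0 \<in> snd c0 ` fst c0" using \<tau>x0 c0 by simp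
  have \<tau>C: "Ck_on 2 S \<tau>" unfolding \<tau>_def S_def by (rule transition_smooth[OF A c c0(1)])
  then have \<tau>C': "Ck_on (Suc (Suc 0)) S \<tau>" by (simp add: numeral_2_eq_2)
  \<comment> \<open>The differential of \<tau> in terms of partial derivatives; in this form it is
    linear at every \<open>x\<close>, and its own derivative at \<open>x0\<close> is visibly
    \<open>D2\<close>.\<close>
  define D where "D x w = (\<Sum>i\<in>UNIV. w $ i *\<^sub>R partial i \<tau> x)" for x w
  define D2 where "D2 h w = (\<Sum>i\<in>UNIV. w $ i *\<^sub>R (\<Sum>j\<in>UNIV. h $ j *\<^sub>R partial j (partial i \<tau>) x0))" for h w
  have D_lin: "linear (D x)" for x
    unfolding D_def by (rule linear_sum_scaleR)
  have D2_lin: "linear (D2 h)" for h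
    unfolding D2_def by (rule linear_sum_scaleR)
  have D_der: "((\<lambda>x. D x w) has_derivative (\<lambda>h. D2 h w)) (at x0)" for w
  proof -
    have "partial i \<tau> differentiable (at x0)" for i
      using \<tau>C' S(2) unfolding Ck_on.simps by blast
    from has_derivative_sum_partial[OF this] show ?thesis
      unfolding D_def D2_def by (intro has_derivative_sum has_derivative_scaleR_right)
  qed
  have D2_commute: "D2 h w = D2 w h" for h w
    unfolding D2_def scaleR_sum_right
    by (subst sum.swap) (simp add: partial_commute_vec[OF S \<tau>C] mult.commute)
  have "\<tau> differentiable (at x0)" using \<tau>C' S(2) unfolding Ck_on.simps by blast
  then have \<tau>_der: "(\<tau> has_derivative D x0) (at x0)"
    unfolding D_def by (rule has_derivative_sum_partial)
  define N where "N x w = E (\<tau> x) (D x w)" for x w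
  \<comment> \<open>The second summand comes from the change of chart. By \<open>D2_commute\<close>
    it is symmetric in \<open>h\<close> and \<open>w\<close>, so it contributes to
    \<open>N' y y\<close> but not to \<open>C\<close>.\<close>
  define N' where "N' h w = E' (\<tau> x0) (D x0 h) (D x0 w) + E (\<tau> x0) (D2 h w)" for h w
  have N_lin: "linear (N x)" for x
    unfolding N_def using linear_compose[OF D_lin E_lin] by (simp add: o_def)
  have N_der: "((\<lambda>x. N x w) has_derivative (\<lambda>h. N' h w)) (at x0)" for w
    unfolding N_def N'_def
  proof (rule has_derivative_linear_family[OF S _ _ _ D_der])
    show "linear (E (\<tau> x))" for x by (rule E_lin)
    show "linear (E' (\<tau> x0) (D x0 h))" for h by (rule E'_lin)
    show "((\<lambda>x. E (\<tau> x) v) has_derivative (\<lambda>h. E' (\<tau> x0) (D x0 h) v)) (at x0)" for v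
      using diff_chain_at[OF \<tau>_der E_der[OF \<tau>x0_in]] by (simp add: o_def)
  qed
  have N'_lin1: "linear (\<lambda>h. N' h w)" for w using N_der by (rule has_derivative_linear)
  have N'_lin2: "linear (N' h)" for h
    unfolding N'_def
    by (intro linear_compose_add linear_compose[OF D_lin E'_lin, unfolded o_def]
        linear_compose[OF D2_lin E_lin, unfolded o_def])
  \<comment> \<open>Shown on the whole overlap of the two charts and not just at \<open>p\<close>,
    because the spray differentiates in position.\<close>
  have N_e: "(\<chi> k. e k p' w) = N (snd c p') (w c)"
    if p': "p' \<in> fst c" "p' \<in> fst c0" and w: "w \<in> tangent_space A p'" for p' w
  proof -
    have "w c0 = frechet_derivative \<tau> (at (snd c p')) (w c)"
      unfolding \<tau>_def by (rule tangent_space_component[OF A w c c0(1) p'])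
    also have "\<dots> = D (snd c p') (w c)"
      unfolding D_def \<tau>_def
      by (rule frechet_derivative_eq_sum_partial[OF transition_differentiable[OF A c c0(1) p']])
    finally show ?thesis
      using E[OF p'(2) w] by (simp add: N_def \<tau>_def transition_apply[OF A c p'(1)])
  qed
  obtain B where B: "\<And>w. B *v N x0 w = w" "\<And>w. N x0 (B *v w) = w"
    using vierbein_isomorphism[OF A c p md c0(2) N_lin N_e[OF p c0(2)]] unfolding x0_def by blast
  have l: "local_lagrangian A \<L> c x y = ?L (N x y)" if "x \<in> S" "N x y \<in> ?\<omega>" for x y
  proof -
    obtain p' where p': "x = snd c p'" "p' \<in> fst c" "p' \<in> fst c0" using \<open>x \<in> S\<close> by (auto simp: S_def)
    show ?thesis
      using local_lagrangian_modeled[OF A c p'(2) \<Omega> md p'(3) N_lin N_e[OF p'(2,3)]] that p'(1) by simp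
  qed
  have B_lin: "linear ((*v) B)" by (rule matrix_vector_mul_linear)
  define C where "C z w = N' (B *v z) (B *v w) - N' (B *v w) (B *v z)" for z w
  have C_E: "C z w = E' (\<tau> x0) (D x0 (B *v z)) (D x0 (B *v w)) - E' (\<tau> x0) (D x0 (B *v w)) (D x0 (B *v z))" for z w
    by (simp add: C_def N'_def D2_commute[of "B *v z"])
  \<comment> \<open>Frame components of the vectors in \<open>C_E\<close>: in particular
    \<open>B *v axis (ix n) 1\<close>, carried to the chart \<open>c0\<close>, meets the hypothesis
    on \<open>w\<close> in \<open>Ei\<close> and \<open>En\<close>.\<close>
  have EB: "E (\<tau> x0) (D x0 (B *v w)) = w" for w using B(2) by (simp add: N_def)
  have "linear (\<lambda>z. C z w)" for w
    unfolding C_def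
    by (intro linear_compose_sub linear_compose[OF B_lin N'_lin1, unfolded o_def]
        linear_compose[OF B_lin N'_lin2, unfolded o_def])
  moreover have "C z w = - C w z" for z w by (simp add: C_def)
  moreover have "C z w $ ix 0 = 0" for z w by (simp add: C_E E0[OF \<tau>x0_in, of "D x0 (B *v z)"])
  moreover have "C z (axis (ix n) 1) $ ix i = 0" if "i \<in> {1..<n}" for z i
    using Ei[OF \<tau>x0_in _ that, of "D x0 (B *v axis (ix n) 1)" "D x0 (B *v z)"]
    by (simp add: C_E EB axis_def)
  moreover have "C z (axis (ix n) 1) $ ix n = 0" if "z $ ix 0 = 0" for z
    using En[OF \<tau>x0_in, of "D x0 (B *v axis (ix n) 1)" "D x0 (B *v z)"] that
    by (simp add: C_E EB axis_def)
  ultimately obtain q :: "real^'m \<Rightarrow> real^'m" where q_quad: "\<And>k. quadratic (\<lambda>z. q z $ k)"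
    and q: "\<And>z w. z \<in> ?\<omega> \<Longrightarrow> (hessian ?L z *v q z) \<bullet> w = (\<Sum>a\<in>UNIV. partial a ?L z * C z w $ a)"
    using bogoslovsky_quadratic_solution[OF n ix pm, of C] by blast
  have spray: "spray (local_lagrangian A \<L> c) x0 y = (1/2) *\<^sub>R (B *v (N' y y + q (N x0 y)))"
    if y: "N x0 y \<in> ?\<omega>" for y
  proof (rule spray_moving_frame[where N = N and N' = N' and M = "(*v) B" and L = ?L
          and l = "local_lagrangian A \<L> c",
        OF S cone_open[OF n ix pm] y _ _ _ _ N_lin N_der B_lin B l])
    have "Ck_on 4 ?\<omega> ?L" using pm unfolding pseudo_minkowski_def by blast
    then have "Ck_on (Suc (Suc 0)) ?\<omega> ?L" by (rule Ck_on_le) simp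
    then show "?L differentiable (at z)" "partial a ?L differentiable (at z)" if "z \<in> ?\<omega>" for z a
      using that unfolding Ck_on.simps by blast+
    show "hessian ?L (N x0 y) $ i $ j = hessian ?L (N x0 y) $ j $ i" for i j
      by (rule bogoslovsky_hessian_symmetric[OF n ix pm y])
    show "invertible (hessian ?L (N x0 y))" using pm y by (simp add: pseudo_minkowski_def)
    show "(hessian ?L (N x0 y) *v q (N x0 y)) \<bullet> N x0 w
        = (\<Sum>a\<in>UNIV. partial a ?L (N x0 y) * (N' y w $ a - N' w y $ a))" for w
      using q[OF y, of "N x0 w"] by (simp add: C_def B)
  qed
  \<comment> \<open>\<open>N' y y\<close> is the diagonal of a bilinear map, and \<open>q\<close> is
    composed with the linear map \<open>N x0\<close>; both are quadratic in
    \<open>y\<close>.\<close>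
  have "quadratic (\<lambda>y. ((1/2) *\<^sub>R (B *v (N' y y + q (N x0 y)))) $ \<mu>)" for \<mu>
  proof -
    have "quadratic (\<lambda>y. N' y y $ k)" for k
      by (rule quadratic_bilinear_self) (intro linear_compose_vec_nth N'_lin1 N'_lin2)+
    then have "quadratic (\<lambda>y. (1/2) * (\<Sum>k\<in>UNIV. B $ \<mu> $ k * (N' y y $ k + q (N x0 y) $ k)))"
      by (intro quadratic_cmult quadratic_sum quadratic_add quadratic_linear_compose[OF q_quad N_lin])
    then show ?thesis by (simp add: matrix_vector_mult_def)
  qed
  then have "\<forall>\<mu>. \<exists>\<Gamma>. \<forall>y. ((1/2) *\<^sub>R (B *v (N' y y + q (N x0 y)))) $ \<mu>
      = (\<Sum>\<alpha>\<in>UNIV. \<Sum>\<beta>\<in>UNIV. \<Gamma> \<alpha> \<beta> * y $ \<alpha> * y $ \<beta>)"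
    unfolding quadratic_def by blast
  from choice[OF this] obtain \<Gamma> where \<Gamma>: "\<And>\<mu> y. ((1/2) *\<^sub>R (B *v (N' y y + q (N x0 y)))) $ \<mu>
      = (\<Sum>\<alpha>\<in>UNIV. \<Sum>\<beta>\<in>UNIV. \<Gamma> \<mu> \<alpha> \<beta> * y $ \<alpha> * y $ \<beta>)"
    by blast
  have cone: "N x0 y \<in> ?\<omega>" if y: "y \<in> fibre_in_chart \<Omega> c p" for y
  proof -
    obtain w where w: "y = w c" "w \<in> fibre \<Omega> p" using y unfolding fibre_in_chart_def by (rule imageE)
    then have "w \<in> tangent_space A p" using \<Omega> by (auto simp: fibre_def tangent_bundle_def)
    moreover have "(\<chi> k. e k p w) \<in> ?\<omega>" using md c0(2) w(2) unfolding modeled_with_vierbein_def by blast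
    ultimately show ?thesis using N_e[OF p c0(2)] w(1) by (simp add: x0_def)
  qed
  show "\<exists>\<Gamma> :: 'm \<Rightarrow> 'm \<Rightarrow> 'm \<Rightarrow> real. \<forall>y\<in>fibre_in_chart \<Omega> c p. \<forall>\<mu>.
        spray (local_lagrangian A \<L> c) (snd c p) y $ \<mu>
          = (\<Sum>\<alpha>\<in>UNIV. \<Sum>\<beta>\<in>UNIV. \<Gamma> \<mu> \<alpha> \<beta> * y $ \<alpha> * y $ \<beta>)"
    using spray[OF cone] \<Gamma> by (intro exI[of _ \<Gamma>]) (simp flip: x0_def)
qed

end
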